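(* Suppose $u_0=0$, $g(t)=e^{-\gamma t}$ with $\gamma\in\mathbb C$, $\gamma\notin \bigcup_{k\in\mathbb Z,\ n\in\mathbb N\setminus\{0\}}\left\{a\lambda_n+i\left(b\lambda_n-\frac{2k\pi}{T}\right)\right\}$, and let $(u,f)\in \left(H^1(0,T;L^2(\Omega))\cap L^2(0,T;H^2(\Omega))\right)\times\left(H^2(\Omega)\cap H_0^1(\Omega)\right)$ be a pair satisfying $$\begin{cases} u_t-(a+ib)\Delta u=g(t)f(x), & (x,t)\in\Omega\times(0,T],\\ u(x,t)=0, & (x,t)\in\partial\Omega\times(0,T],\\ u(x,0)=u_0(x), & x\in\Omega,\end{cases}$$ with corresponding measurement data $u(\cdot,T)$ in $\Omega\subset\mathbb R^d$. If $\|f\|_{H^2(\Omega)\cap H_0^1(\Omega)}\le M$ for some positive constant $M$, then there exists a constant $C=C(a,b,d,\gamma,T,M,\Omega)$ such that $$\|f\|_{L^2(\Omega)}\le C M^{\frac12}\|u(\cdot,T)\|_{L^2(\Omega)}^{\frac12}.$$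
   Context: Here $a,b\in\mathbb R$ with $a>0$, $b\ne0$; $T>0$; $\Omega\subset\mathbb R^d$, $d\ge1$, is a bounded domain whose boundary $\partial\Omega$ is an analytic hypersurface. Functions are complex-valued. $\{\lambda_n,\varphi_n\}_{n\ge1}$ is the Dirichlet eigensystem of $-\Delta$ on $\Omega$ (domain $H^2(\Omega)\cap H_0^1(\Omega)$), with $0<\lambda_1\le\lambda_2\le\cdots$ and $\{\varphi_n\}$ an orthonormal basis of $L^2(\Omega)$. The constant $C$ depends only on the listed quantities, not on the particular pair $(u,f)$. *)

theory Defs
  imports "HOL-Analysis.Analysis"
begin

text \<open>
  Elements of \<open>L\<^sup>2(\<Omega>)\<close> and of the Sobolev spaces are represented by total functions; only their
  values almost everywhere on \<open>\<Omega>\<close> matter, and the norms below are seminorms on representatives.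
\<close>

definition L2 :: "'a::euclidean_space set \<Rightarrow> ('a \<Rightarrow> complex) set" where
  "L2 \<Omega> = {f. f \<in> borel_measurable (lebesgue_on \<Omega>) \<and>
               integrable (lebesgue_on \<Omega>) (\<lambda>x. (cmod (f x))\<^sup>2)}"

definition L2_norm :: "'a::euclidean_space set \<Rightarrow> ('a \<Rightarrow> complex) \<Rightarrow> real" where
  "L2_norm \<Omega> f = sqrt (LINT x|lebesgue_on \<Omega>. (cmod (f x))\<^sup>2)"

definition L2_inner :: "'a::euclidean_space set \<Rightarrow> ('a \<Rightarrow> complex) \<Rightarrow> ('a \<Rightarrow> complex) \<Rightarrow> complex" where
  "L2_inner \<Omega> f g = (LINT x|lebesgue_on \<Omega>. f x * cnj (g x))"

definition pderiv_dir :: "'a::euclidean_space \<Rightarrow> ('a \<Rightarrow> 'b::real_normed_vector) \<Rightarrow> 'a \<Rightarrow> 'b" where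
  "pderiv_dir b f x = frechet_derivative f (at x) b"

primrec Ck :: "nat \<Rightarrow> ('a::euclidean_space \<Rightarrow> 'b::real_normed_vector) \<Rightarrow> bool" where
  "Ck 0 f \<longleftrightarrow> continuous_on UNIV f"
| "Ck (Suc k) f \<longleftrightarrow> (\<forall>x. f differentiable (at x)) \<and> (\<forall>b\<in>Basis. Ck k (pderiv_dir b f))"

definition test_function :: "'a::euclidean_space set \<Rightarrow> ('a \<Rightarrow> 'b::real_normed_vector) \<Rightarrow> bool" where
  "test_function \<Omega> \<psi> \<longleftrightarrow>
     (\<forall>k. Ck k \<psi>) \<and> compact (closure {x. \<psi> x \<noteq> 0}) \<and> closure {x. \<psi> x \<noteq> 0} \<subseteq> \<Omega>"

definition has_weak_pderiv ::
    "'a::euclidean_space set \<Rightarrow> 'a \<Rightarrow> ('a \<Rightarrow> complex) \<Rightarrow> ('a \<Rightarrow> complex) \<Rightarrow> bool" where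
  "has_weak_pderiv \<Omega> b u v \<longleftrightarrow>
     (\<forall>\<psi>::'a \<Rightarrow> complex. test_function \<Omega> \<psi> \<longrightarrow>
        (LINT x|lebesgue_on \<Omega>. u x * pderiv_dir b \<psi> x) = - (LINT x|lebesgue_on \<Omega>. v x * \<psi> x))"

text \<open>A representative of the weak derivative, which is unique up to null sets.\<close>

definition weak_pderiv :: "'a::euclidean_space set \<Rightarrow> 'a \<Rightarrow> ('a \<Rightarrow> complex) \<Rightarrow> 'a \<Rightarrow> complex" where
  "weak_pderiv \<Omega> b u = (SOME v. v \<in> L2 \<Omega> \<and> has_weak_pderiv \<Omega> b u v)"

text \<open>
  \<open>sobolev k \<Omega>\<close> is \<open>H\<^sup>k(\<Omega>) = W\<^bsup>k,2\<^esup>(\<Omega>)\<close>. The norm sums the squared \<open>L\<^sup>2\<close> norms of all iterated partial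
  derivatives of order at most \<open>k\<close>, ordered tuples of directions being counted separately; for
  \<open>k = 2\<close> its square is the sum of the squared \<open>L\<^sup>2\<close> norms of the function, of its gradient and
  of its Hessian (Frobenius norm).
\<close>

primrec sobolev :: "nat \<Rightarrow> 'a::euclidean_space set \<Rightarrow> ('a \<Rightarrow> complex) set" where
  "sobolev 0 \<Omega> = L2 \<Omega>"
| "sobolev (Suc k) \<Omega> =
     {u \<in> L2 \<Omega>. \<forall>b\<in>Basis. \<exists>v \<in> sobolev k \<Omega>. has_weak_pderiv \<Omega> b u v}"

primrec sobolev_norm :: "nat \<Rightarrow> 'a::euclidean_space set \<Rightarrow> ('a \<Rightarrow> complex) \<Rightarrow> real" where
  "sobolev_norm 0 \<Omega> u = L2_norm \<Omega> u"
| "sobolev_norm (Suc k) \<Omega> u =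
     sqrt ((L2_norm \<Omega> u)\<^sup>2 + (\<Sum>b\<in>Basis. (sobolev_norm k \<Omega> (weak_pderiv \<Omega> b u))\<^sup>2))"

text \<open>\<open>H\<^sub>0\<^sup>1(\<Omega>)\<close>: the closure of the test functions in \<open>H\<^sup>1(\<Omega>)\<close>.\<close>

definition H10 :: "'a::euclidean_space set \<Rightarrow> ('a \<Rightarrow> complex) set" where
  "H10 \<Omega> = {u \<in> sobolev 1 \<Omega>. \<exists>\<psi>::nat \<Rightarrow> 'a \<Rightarrow> complex. (\<forall>n. test_function \<Omega> (\<psi> n)) \<and>
                (\<lambda>n. sobolev_norm 1 \<Omega> (\<lambda>x. u x - \<psi> n x)) \<longlonglongrightarrow> 0}"

definition laplacian :: "'a::euclidean_space set \<Rightarrow> ('a \<Rightarrow> complex) \<Rightarrow> 'a \<Rightarrow> complex" where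
  "laplacian \<Omega> u x = (\<Sum>b\<in>Basis. weak_pderiv \<Omega> b (weak_pderiv \<Omega> b u) x)"

text \<open>
  The Bochner space \<open>L\<^sup>2(0,T;X)\<close>, where \<open>X\<close> carries the seminorm \<open>N\<close>: strongly measurable functions
  (almost everywhere limits in \<open>X\<close> of measurable functions with finitely many values) with
  square-integrable norm.
\<close>

definition bochner_L2 ::
    "real \<Rightarrow> ('a \<Rightarrow> complex) set \<Rightarrow> (('a \<Rightarrow> complex) \<Rightarrow> real) \<Rightarrow> (real \<Rightarrow> 'a \<Rightarrow> complex) set" where
  "bochner_L2 T X N =
     {u. (AE t in lebesgue_on {0<..<T}. u t \<in> X) \<and>
         (\<exists>s::nat \<Rightarrow> real \<Rightarrow> 'a \<Rightarrow> complex.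
             (\<forall>n. simple_function (lebesgue_on {0<..<T}) (s n) \<and> (\<forall>t\<in>{0<..<T}. s n t \<in> X)) \<and>
             (AE t in lebesgue_on {0<..<T}. (\<lambda>n. N (\<lambda>x. u t x - s n t x)) \<longlonglongrightarrow> 0)) \<and>
         integrable (lebesgue_on {0<..<T}) (\<lambda>t. (N (u t))\<^sup>2)}"

abbreviation L2_time_L2 :: "real \<Rightarrow> 'a::euclidean_space set \<Rightarrow> (real \<Rightarrow> 'a \<Rightarrow> complex) set" where
  "L2_time_L2 T \<Omega> \<equiv> bochner_L2 T (L2 \<Omega>) (L2_norm \<Omega>)"

abbreviation L2_time_H2 :: "real \<Rightarrow> 'a::euclidean_space set \<Rightarrow> (real \<Rightarrow> 'a \<Rightarrow> complex) set" where
  "L2_time_H2 T \<Omega> \<equiv> bochner_L2 T (sobolev 2 \<Omega>) (sobolev_norm 2 \<Omega>)"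

text \<open>
  The identity \<open>\<integral> \<eta>' u dt = - \<integral> \<eta> v dt\<close> between \<open>L\<^sup>2(\<Omega>)\<close>-valued Bochner integrals, tested
  against every \<open>w \<in> L\<^sup>2(\<Omega>)\<close>.
\<close>

definition has_weak_time_deriv ::
    "real \<Rightarrow> 'a::euclidean_space set \<Rightarrow> (real \<Rightarrow> 'a \<Rightarrow> complex) \<Rightarrow> (real \<Rightarrow> 'a \<Rightarrow> complex) \<Rightarrow> bool" where
  "has_weak_time_deriv T \<Omega> u v \<longleftrightarrow>
     (\<forall>\<eta>::real \<Rightarrow> real. test_function {0<..<T} \<eta> \<longrightarrow> (\<forall>w \<in> L2 \<Omega>.
        (LINT t|lebesgue_on {0<..<T}. of_real (deriv \<eta> t) * L2_inner \<Omega> (u t) w) =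
        - (LINT t|lebesgue_on {0<..<T}. of_real (\<eta> t) * L2_inner \<Omega> (v t) w)))"

definition H1_time_L2 :: "real \<Rightarrow> 'a::euclidean_space set \<Rightarrow> (real \<Rightarrow> 'a \<Rightarrow> complex) set" where
  "H1_time_L2 T \<Omega> = {u \<in> L2_time_L2 T \<Omega>. \<exists>v \<in> L2_time_L2 T \<Omega>. has_weak_time_deriv T \<Omega> u v}"

definition weak_time_deriv ::
    "real \<Rightarrow> 'a::euclidean_space set \<Rightarrow> (real \<Rightarrow> 'a \<Rightarrow> complex) \<Rightarrow> real \<Rightarrow> 'a \<Rightarrow> complex" where
  "weak_time_deriv T \<Omega> u = (SOME v. v \<in> L2_time_L2 T \<Omega> \<and> has_weak_time_deriv T \<Omega> u v)"

definition L2_continuous :: "real \<Rightarrow> 'a::euclidean_space set \<Rightarrow> (real \<Rightarrow> 'a \<Rightarrow> complex) \<Rightarrow> bool" where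
  "L2_continuous T \<Omega> u \<longleftrightarrow> (\<forall>t\<in>{0..T}. u t \<in> L2 \<Omega> \<and>
     ((\<lambda>s. L2_norm \<Omega> (\<lambda>x. u s x - u t x)) \<longlongrightarrow> 0) (at t within {0..T}))"

text \<open>
  \<open>u t x\<close> stands for \<open>u(x,t)\<close>. Since \<open>H\<^sup>1(0,T;L\<^sup>2(\<Omega>))\<close> embeds into \<open>C([0,T];L\<^sup>2(\<Omega>))\<close>, every element
  has exactly one continuous representative, and \<open>u(\<sqdot>,0)\<close> and \<open>u(\<sqdot>,T)\<close> are by convention its values.
  The conjunct \<open>L2_continuous\<close> says that \<open>u\<close> is this representative, so that these traces are simply
  \<open>u 0\<close> and \<open>u T\<close>. The equation holds almost everywhere, and the Dirichlet condition in the sense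
  of traces, that is, as membership in \<open>H\<^sub>0\<^sup>1(\<Omega>)\<close>.
\<close>

definition solves_ibvp ::
    "real \<Rightarrow> real \<Rightarrow> real \<Rightarrow> 'a::euclidean_space set \<Rightarrow> (real \<Rightarrow> complex) \<Rightarrow> ('a \<Rightarrow> complex) \<Rightarrow>
     ('a \<Rightarrow> complex) \<Rightarrow> (real \<Rightarrow> 'a \<Rightarrow> complex) \<Rightarrow> bool" where
  "solves_ibvp a b T \<Omega> g f u0 u \<longleftrightarrow>
     L2_continuous T \<Omega> u \<and>
     (AE t in lebesgue_on {0<..<T}. AE x in lebesgue_on \<Omega>.
        weak_time_deriv T \<Omega> u t x - Complex a b * laplacian \<Omega> (u t) x = g t * f x) \<and>
     (AE t in lebesgue_on {0<..<T}. u t \<in> H10 \<Omega>) \<and>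
     (AE x in lebesgue_on \<Omega>. u 0 x = u0 x)"

text \<open>
  Multi-indices are functions from the coordinate type to \<open>nat\<close>; the power series converges
  unconditionally, hence absolutely.
\<close>

definition real_analytic_on :: "(real^'d \<Rightarrow> real) \<Rightarrow> (real^'d) set \<Rightarrow> bool"
    (infix "real'_analytic'_on" 50) where
  "h real_analytic_on U \<longleftrightarrow>
     (\<forall>p\<in>U. \<exists>r>0. \<exists>c::('d \<Rightarrow> nat) \<Rightarrow> real. \<forall>x\<in>ball p r.
        ((\<lambda>\<alpha>. c \<alpha> * (\<Prod>i\<in>UNIV. (x $ i - p $ i) ^ \<alpha> i)) has_sum h x) UNIV)"

definition analytic_hypersurface :: "(real^'d) set \<Rightarrow> bool" where
  "analytic_hypersurface S \<longleftrightarrow>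
     (\<forall>p\<in>S. \<exists>U h. open U \<and> p \<in> U \<and> h real_analytic_on U \<and>
        (\<forall>x\<in>U. frechet_derivative h (at x) \<noteq> (\<lambda>_. 0)) \<and>
        S \<inter> U = {x\<in>U. h x = 0})"

text \<open>Indexed by \<open>n \<ge> 1\<close>; the values at \<open>0\<close> are irrelevant.\<close>

definition dirichlet_eigensystem ::
    "'a::euclidean_space set \<Rightarrow> (nat \<Rightarrow> real) \<Rightarrow> (nat \<Rightarrow> 'a \<Rightarrow> complex) \<Rightarrow> bool" where
  "dirichlet_eigensystem \<Omega> ev \<phi> \<longleftrightarrow>
     (\<forall>n\<ge>1. 0 < ev n \<and> ev n \<le> ev (Suc n)) \<and>
     (\<forall>n\<ge>1. \<phi> n \<in> sobolev 2 \<Omega> \<inter> H10 \<Omega> \<and>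
        (AE x in lebesgue_on \<Omega>. - laplacian \<Omega> (\<phi> n) x = of_real (ev n) * \<phi> n x)) \<and>
     (\<forall>m\<ge>1. \<forall>n\<ge>1. L2_inner \<Omega> (\<phi> m) (\<phi> n) = (if m = n then 1 else 0)) \<and>
     (\<forall>f \<in> L2 \<Omega>. (\<lambda>N. L2_norm \<Omega> (\<lambda>x. f x - (\<Sum>n=1..N. L2_inner \<Omega> f (\<phi> n) * \<phi> n x))) \<longlonglongrightarrow> 0)"

end

theory Submission
  imports Defs
begin

text \<open>
  The coefficients \<open>u\<^sub>n\<close> and \<open>f\<^sub>n\<close> of \<open>u\<close> and \<open>f\<close> in the eigenbasis satisfy
  \<open>u\<^sub>n' + \<mu>\<^sub>n u\<^sub>n = e\<^bsup>-\<gamma>t\<^esup> f\<^sub>n\<close> with \<open>\<mu>\<^sub>n = (a + ib) \<lambda>\<^sub>n\<close>, so that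
  \<open>(\<mu>\<^sub>n - \<gamma>) u\<^sub>n(T) = (e\<^bsup>-\<gamma>T\<^esup> - e\<^bsup>-\<mu>\<^sub>nT\<^esup>) f\<^sub>n\<close>. The hypothesis on \<open>\<gamma>\<close> says that the factor
  on the right does not vanish, and as \<open>\<lambda>\<^sub>n\<close> tends to infinity it stays away from zero, whence
  \<open>\<bar>f\<^sub>n\<bar> \<le> K \<lambda>\<^sub>n \<bar>u\<^sub>n(T)\<bar>\<close>. Multiplying by \<open>\<bar>f\<^sub>n\<bar>\<close>, summing and using the Cauchy-Schwarz inequality
  bounds \<open>\<parallel>f\<parallel>\<^sup>2\<close> by \<open>K \<parallel>\<Delta>f\<parallel> \<parallel>u(T)\<parallel>\<close>.
\<close>

subsection \<open>Smooth and test functions\<close>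

text \<open>\<open>dirichlet_eigensystem\<close> only makes the eigenvalues positive and
  nondecreasing, and weak derivatives are arbitrary choices. Completeness of the eigenfunctions
  settles both points. Each eigenfunction is a limit of test functions, so an element of
  \<open>L2\<close> orthogonal to all test functions has vanishing coefficients and is null; hence
  weak derivatives are unique up to null functions. By Parseval, bounded eigenvalues would bound the
  Laplacian, and with it the gradient, on test functions, which oscillation refutes.

  The other obstacle is time: the equation holds for almost every t with a weak derivative, whereas
  the values at 0 and T are needed. The scalar equation of each coefficient has a right side
  continuous in t, so the coefficient is differentiable up to both endpoints and can be solved for
  explicitly.

  The exponent 1/2 is an interpolation: dividing by the exponential factor costs one power of the
  eigenvalue, which is paid for by the Laplacian of f, of size at most d M.\<close>

lemma pderiv_dir_eq: "(f has_derivative f') (at x) \<Longrightarrow> pderiv_dir b f x = f' b"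
  unfolding pderiv_dir_def using frechet_derivative_at by metis

lemma Ck_differentiable: "Ck (Suc k) f \<Longrightarrow> f differentiable (at x)"
  by simp

lemma Ck_has_derivative: "Ck (Suc k) f \<Longrightarrow> (f has_derivative (\<lambda>b. pderiv_dir b f x)) (at x)"
  unfolding pderiv_dir_def using frechet_derivative_works by force

text \<open>\<open>Ck\<close> peels off derivatives from the outside and asks for continuity only at
  the last level. The induction therefore varies \<open>f\<close>, and its base case is that
  differentiability implies continuity.\<close>

lemma Ck_Suc_imp: "Ck (Suc k) f \<Longrightarrow> Ck k f"
proof (induction k arbitrary: f)
  case 0
  then show ?case
    by (auto intro!: continuous_at_imp_continuous_on differentiable_imp_continuous_within)
next
  case (Suc k)
  then show ?case by (subst Ck.simps) (auto simp del: Ck.simps(1) simp: Ck.simps(2)[of "Suc k"])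
qed

lemma Ck_imp_continuous: "Ck k f \<Longrightarrow> continuous_on UNIV f"
  by (induction k) (auto dest: Ck_Suc_imp simp del: Ck.simps(2))

lemma pderiv_dir_linear:
  assumes "bounded_linear L" "Ck (Suc k) f"
  shows "pderiv_dir b (\<lambda>x. L (f x)) = (\<lambda>x. L (pderiv_dir b f x))"
proof
  fix x
  show "pderiv_dir b (\<lambda>x. L (f x)) x = L (pderiv_dir b f x)"
    using bounded_linear.has_derivative[OF assms(1) Ck_has_derivative[OF assms(2), of x]]
    by (rule pderiv_dir_eq)
qed

lemma Ck_linear:
  assumes L: "bounded_linear L"
  shows "Ck k f \<Longrightarrow> Ck k (\<lambda>x. L (f x))"
proof (induction k arbitrary: f)
  case 0
  then show ?case by (simp add: bounded_linear.continuous_on[OF L])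
next
  case (Suc k)
  have "(\<lambda>x. L (f x)) differentiable (at x)" for x
    using bounded_linear.has_derivative[OF L Ck_has_derivative[OF Suc.prems, of x]]
    by (auto simp: differentiable_def)
  moreover have "Ck k (pderiv_dir b (\<lambda>x. L (f x)))" if "b \<in> Basis" for b
    unfolding pderiv_dir_linear[OF L Suc.prems] by (rule Suc.IH) (use Suc.prems that in simp)
  ultimately show ?case by simp
qed

lemma Ck_add: "Ck k f \<Longrightarrow> Ck k g \<Longrightarrow> Ck k (\<lambda>x. f x + g x)"
proof (induction k arbitrary: f g)
  case 0
  then show ?case by (simp add: continuous_on_add)
next
  case (Suc k)
  note d = has_derivative_add[OF Ck_has_derivative[OF Suc.prems(1)] Ck_has_derivative[OF Suc.prems(2)]]
  have "(\<lambda>x. f x + g x) differentiable (at x)" for x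
    using d[of x] by (auto simp: differentiable_def)
  moreover have "pderiv_dir b (\<lambda>x. f x + g x) = (\<lambda>x. pderiv_dir b f x + pderiv_dir b g x)" for b
    using pderiv_dir_eq[OF d] by (intro ext)
  moreover have "Ck k (\<lambda>x. pderiv_dir b f x + pderiv_dir b g x)" if "b \<in> Basis" for b
    by (rule Suc.IH) (use Suc.prems that in simp_all)
  ultimately show ?case by simp
qed

lemma pderiv_dir_mult:
  fixes f g :: "'a::euclidean_space \<Rightarrow> 'b::real_normed_algebra"
  assumes "Ck (Suc k) f" "Ck (Suc l) g"
  shows "pderiv_dir b (\<lambda>x. f x * g x) = (\<lambda>x. f x * pderiv_dir b g x + pderiv_dir b f x * g x)"
  using pderiv_dir_eq[OF has_derivative_mult[OF Ck_has_derivative[OF assms(1)] Ck_has_derivative[OF assms(2)]]]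
  by (intro ext)

lemma Ck_mult:
  fixes f g :: "'a::euclidean_space \<Rightarrow> 'b::real_normed_algebra"
  shows "Ck k f \<Longrightarrow> Ck k g \<Longrightarrow> Ck k (\<lambda>x. f x * g x)"
proof (induction k arbitrary: f g)
  case 0
  then show ?case by (simp add: continuous_on_mult)
next
  case (Suc k)
  have "(\<lambda>x. f x * g x) differentiable (at x)" for x
    using Suc.prems by (auto intro: differentiable_mult)
  moreover have "Ck k (pderiv_dir b (\<lambda>x. f x * g x))" if b: "b \<in> Basis" for b
  proof -
    have "Ck k (pderiv_dir b f)" "Ck k (pderiv_dir b g)"
      using Suc.prems b by simp_all
    then have "Ck k (\<lambda>x. f x * pderiv_dir b g x + pderiv_dir b f x * g x)"
      using Ck_add[OF Suc.IH[OF Ck_Suc_imp[OF Suc.prems(1)]] Suc.IH[OF _ Ck_Suc_imp[OF Suc.prems(2)]]]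
      by blast
    then show ?thesis by (simp only: pderiv_dir_mult[OF Suc.prems])
  qed
  ultimately show ?case by simp
qed

text \<open>A factor of modulus one whose derivative along \<open>e\<close> has size proportional to
  \<kappa>: multiplying by it keeps \<open>L2\<close> norms and inflates gradients, which is what
  forces the eigenvalues to be unbounded.\<close>

abbreviation plane_wave :: "real \<Rightarrow> 'a::euclidean_space \<Rightarrow> 'a \<Rightarrow> complex" where
  "plane_wave \<kappa> e x \<equiv> exp (\<i> * of_real (\<kappa> * (x \<bullet> e)))"

lemma plane_wave_has_derivative:
  "(plane_wave \<kappa> e has_derivative (\<lambda>h. \<i> * of_real (\<kappa> * (h \<bullet> e)) * plane_wave \<kappa> e x)) (at x)"
proof -
  have "((\<lambda>x. \<i> * of_real (\<kappa> * (x \<bullet> e))) has_derivative (\<lambda>h. \<i> * of_real (\<kappa> * (h \<bullet> e)))) (at x)"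
    by (auto intro!: derivative_eq_intros)
  from has_derivative_compose[OF this DERIV_exp[unfolded has_field_derivative_def]]
  show ?thesis by (simp add: mult_ac)
qed

lemma pderiv_dir_plane_wave:
  "pderiv_dir b (plane_wave \<kappa> e) = (\<lambda>x. (\<i> * of_real (\<kappa> * (b \<bullet> e))) * plane_wave \<kappa> e x)"
  using pderiv_dir_eq[OF plane_wave_has_derivative] by (intro ext)

lemma Ck_plane_wave: "Ck k (plane_wave \<kappa> e)"
proof (induction k)
  case 0
  show ?case by (auto intro!: continuous_intros)
next
  case (Suc k)
  have "plane_wave \<kappa> e differentiable (at x)" for x
    using plane_wave_has_derivative by (auto simp: differentiable_def)
  moreover have "Ck k (pderiv_dir b (plane_wave \<kappa> e))" for b
    unfolding pderiv_dir_plane_wave by (rule Ck_linear[OF bounded_linear_mult_right Suc.IH])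
  ultimately show ?case by simp
qed

section \<open>Closure properties of test functions\<close>

lemma test_function_Ck: "test_function \<Omega> \<psi> \<Longrightarrow> Ck k \<psi>"
  by (simp add: test_function_def)

text \<open>The third premise refers to the closed support of \<psi> rather than to its zero set.
  Its complement is open, so the premise is also met by derivatives of \<psi>, which may fail to
  vanish at isolated zeros of \<psi>.\<close>

lemma test_function_supportI:
  assumes "test_function \<Omega> \<psi>" "\<And>k. Ck k \<zeta>" "\<And>x. x \<notin> closure {x. \<psi> x \<noteq> 0} \<Longrightarrow> \<zeta> x = 0"
  shows "test_function \<Omega> \<zeta>"
proof -
  let ?S = "closure {x. \<psi> x \<noteq> 0}"
  have "closure {x. \<zeta> x \<noteq> 0} \<subseteq> ?S"
    using assms(3) by (intro closure_minimal) auto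
  moreover have "compact ?S" "?S \<subseteq> \<Omega>" using assms(1) by (auto simp: test_function_def)
  ultimately have "compact (closure {x. \<zeta> x \<noteq> 0})" "closure {x. \<zeta> x \<noteq> 0} \<subseteq> \<Omega>"
    using compact_Int_closed[of ?S "closure {x. \<zeta> x \<noteq> 0}"] by (auto simp: Int_absorb1)
  then show ?thesis using assms(2) by (simp add: test_function_def)
qed

lemma eq_0_outside_support: "x \<notin> closure {x. \<psi> x \<noteq> 0} \<Longrightarrow> \<psi> x = 0"
  using closure_subset[of "{x. \<psi> x \<noteq> 0}"] by auto

lemma test_function_outside: "test_function \<Omega> \<psi> \<Longrightarrow> x \<notin> \<Omega> \<Longrightarrow> \<psi> x = 0"
  unfolding test_function_def by (auto intro: eq_0_outside_support)

lemma test_function_mult: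
  fixes \<psi> :: "'a::euclidean_space \<Rightarrow> 'b::real_normed_algebra"
  assumes "test_function \<Omega> \<psi>" "\<And>k. Ck k g"
  shows "test_function \<Omega> (\<lambda>x. \<psi> x * g x)"
  using assms(1)
proof (rule test_function_supportI)
  show "Ck k (\<lambda>x. \<psi> x * g x)" for k
    by (intro Ck_mult test_function_Ck[OF assms(1)] assms(2))
  show "\<psi> x * g x = 0" if "x \<notin> closure {x. \<psi> x \<noteq> 0}" for x
    using eq_0_outside_support[OF that] by simp
qed

lemma test_function_linear:
  assumes "test_function \<Omega> \<psi>" "bounded_linear L"
  shows "test_function \<Omega> (\<lambda>x. L (\<psi> x))"
  using assms(1)
proof (rule test_function_supportI)
  show "Ck k (\<lambda>x. L (\<psi> x))" for k
    by (rule Ck_linear[OF assms(2) test_function_Ck[OF assms(1)]])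
  show "L (\<psi> x) = 0" if "x \<notin> closure {x. \<psi> x \<noteq> 0}" for x
  proof -
    have "\<psi> x = 0" by (rule eq_0_outside_support[OF that])
    then show ?thesis by (simp add: linear_0[OF bounded_linear.linear[OF assms(2)]])
  qed
qed

lemma test_function_pderiv_dir:
  assumes "test_function \<Omega> \<psi>" "b \<in> Basis"
  shows "test_function \<Omega> (pderiv_dir b \<psi>)"
  using assms(1)
proof (rule test_function_supportI)
  show "Ck k (pderiv_dir b \<psi>)" for k
    using test_function_Ck[OF assms(1), of "Suc k"] assms(2) by simp
  show "pderiv_dir b \<psi> x = 0" if x: "x \<notin> closure {x. \<psi> x \<noteq> 0}" for x
  proof -
    have "(\<psi> has_derivative (\<lambda>h. 0)) (at x)"
    proof (rule has_derivative_transform_within_open[of "\<lambda>x. 0"])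
      show "open (- closure {x. \<psi> x \<noteq> 0})" by (intro open_Compl closed_closure)
      show "0 = \<psi> y" if "y \<in> - closure {x. \<psi> x \<noteq> 0}" for y
        using that eq_0_outside_support[of y \<psi>] by simp
    qed (use x in auto)
    then show ?thesis by (rule pderiv_dir_eq)
  qed
qed

lemma test_function_bounded:
  assumes "test_function \<Omega> \<psi>"
  obtains B where "B \<ge> 0" "\<And>x. norm (\<psi> x) \<le> B"
proof -
  let ?S = "closure {x. \<psi> x \<noteq> 0}"
  have "compact ?S" "continuous_on ?S \<psi>"
    using assms Ck_imp_continuous[OF test_function_Ck[OF assms, of 0]]
    by (auto simp: test_function_def intro: continuous_on_subset)
  then have "bounded (\<psi> ` ?S)"
    by (intro compact_imp_bounded compact_continuous_image)
  then obtain B where "B > 0" and B: "\<And>x. x \<in> ?S \<Longrightarrow> norm (\<psi> x) \<le> B"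
    unfolding bounded_pos by auto
  show ?thesis
  proof (rule that[of B])
    show "norm (\<psi> x) \<le> B" for x
      using B[of x] closure_subset[of "{x. \<psi> x \<noteq> 0}"] \<open>B > 0\<close> by (cases "\<psi> x = 0") auto
  qed (use \<open>B > 0\<close> in simp)
qed

subsection \<open>The space of square-integrable functions\<close>

lemma L2_measurable: "f \<in> L2 \<Omega> \<Longrightarrow> f \<in> borel_measurable (lebesgue_on \<Omega>)"
  and L2_square_integrable: "f \<in> L2 \<Omega> \<Longrightarrow> integrable (lebesgue_on \<Omega>) (\<lambda>x. (cmod (f x))\<^sup>2)"
  by (auto simp: L2_def)

lemma L2_dominated:
  assumes "f \<in> L2 \<Omega>" "g \<in> L2 \<Omega>" "h \<in> borel_measurable (lebesgue_on \<Omega>)"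
    and le: "\<And>x. (cmod (h x))\<^sup>2 \<le> c * (cmod (f x))\<^sup>2 + d * (cmod (g x))\<^sup>2"
  shows "h \<in> L2 \<Omega>"
proof -
  have "integrable (lebesgue_on \<Omega>) (\<lambda>x. c * (cmod (f x))\<^sup>2 + d * (cmod (g x))\<^sup>2)"
    using assms by (intro Bochner_Integration.integrable_add integrable_mult_right L2_square_integrable)
  then have "integrable (lebesgue_on \<Omega>) (\<lambda>x. (cmod (h x))\<^sup>2)"
    by (rule Bochner_Integration.integrable_bound) (use assms(3) order_trans[OF le abs_ge_self] in auto)
  then show ?thesis using assms(3) by (simp add: L2_def)
qed

lemma cmod_add_square_le: "(cmod (z + w))\<^sup>2 \<le> 2 * (cmod z)\<^sup>2 + 2 * (cmod w)\<^sup>2"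
proof -
  have "(cmod (z + w))\<^sup>2 \<le> (cmod z + cmod w)\<^sup>2" by (intro power_mono norm_triangle_ineq) simp
  also have "\<dots> \<le> 2 * (cmod z)\<^sup>2 + 2 * (cmod w)\<^sup>2"
    using zero_le_power2[of "cmod z - cmod w"] by (simp add: power2_eq_square algebra_simps)
  finally show ?thesis .
qed

lemma L2_add: "f \<in> L2 \<Omega> \<Longrightarrow> g \<in> L2 \<Omega> \<Longrightarrow> (\<lambda>x. f x + g x) \<in> L2 \<Omega>"
  by (rule L2_dominated[of f _ g _ 2 2])
     (auto intro!: borel_measurable_add cmod_add_square_le simp: L2_measurable)

lemma L2_cmult: "f \<in> L2 \<Omega> \<Longrightarrow> (\<lambda>x. c * f x) \<in> L2 \<Omega>"
  by (rule L2_dominated[of f _ f _ "(cmod c)\<^sup>2" 0])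
     (auto dest: L2_measurable simp: norm_mult power_mult_distrib)

lemma L2_uminus: "f \<in> L2 \<Omega> \<Longrightarrow> (\<lambda>x. - f x) \<in> L2 \<Omega>"
  using L2_cmult[of f \<Omega> "-1"] by simp

lemma L2_diff: "f \<in> L2 \<Omega> \<Longrightarrow> g \<in> L2 \<Omega> \<Longrightarrow> (\<lambda>x. f x - g x) \<in> L2 \<Omega>"
  using L2_add[OF _ L2_uminus] by fastforce

lemma L2_zero: "(\<lambda>x. 0) \<in> L2 \<Omega>"
  by (simp add: L2_def)

lemma L2_sum: "(\<And>i. i \<in> I \<Longrightarrow> F i \<in> L2 \<Omega>) \<Longrightarrow> (\<lambda>x. \<Sum>i\<in>I. F i x) \<in> L2 \<Omega>"
  by (induction I rule: infinite_finite_induct) (auto intro: L2_add L2_zero)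

lemma L2_cnj: "f \<in> L2 \<Omega> \<Longrightarrow> (\<lambda>x. cnj (f x)) \<in> L2 \<Omega>"
  by (auto simp: L2_def intro!: borel_measurable_continuous_on[of cnj] continuous_intros)

lemma L2_mult_integrable:
  assumes "f \<in> L2 \<Omega>" "g \<in> L2 \<Omega>"
  shows "integrable (lebesgue_on \<Omega>) (\<lambda>x. f x * g x)"
proof -
  have "integrable (lebesgue_on \<Omega>) (\<lambda>x. (cmod (f x))\<^sup>2 + (cmod (g x))\<^sup>2)"
    using assms by (intro Bochner_Integration.integrable_add integrable_mult_right L2_square_integrable)
  then show ?thesis
  proof (rule Bochner_Integration.integrable_bound)
    have "norm (f x * g x) \<le> norm ((cmod (f x))\<^sup>2 + (cmod (g x))\<^sup>2)" for x
      using sum_squares_bound[of "cmod (f x)" "cmod (g x)"] mult_nonneg_nonneg[of "cmod (f x)" "cmod (g x)"]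
      unfolding norm_mult by (simp del: mult_nonneg_nonneg zero_le_mult_iff)
    then show "AE x in lebesgue_on \<Omega>. norm (f x * g x) \<le> norm ((cmod (f x))\<^sup>2 + (cmod (g x))\<^sup>2)" by simp
  qed (intro borel_measurable_times L2_measurable assms)
qed

lemma L2_inner_integrable:
  "f \<in> L2 \<Omega> \<Longrightarrow> g \<in> L2 \<Omega> \<Longrightarrow> integrable (lebesgue_on \<Omega>) (\<lambda>x. f x * cnj (g x))"
  by (intro L2_mult_integrable L2_cnj)

lemma L2_inner_add_left:
  "f \<in> L2 \<Omega> \<Longrightarrow> g \<in> L2 \<Omega> \<Longrightarrow> h \<in> L2 \<Omega> \<Longrightarrow>
    L2_inner \<Omega> (\<lambda>x. f x + g x) h = L2_inner \<Omega> f h + L2_inner \<Omega> g h"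
  unfolding L2_inner_def by (simp add: distrib_right L2_inner_integrable)

lemma L2_inner_cmult_left: "L2_inner \<Omega> (\<lambda>x. c * f x) h = c * L2_inner \<Omega> f h"
  unfolding L2_inner_def by (simp add: mult.assoc)

lemma L2_inner_diff_left:
  "f \<in> L2 \<Omega> \<Longrightarrow> g \<in> L2 \<Omega> \<Longrightarrow> h \<in> L2 \<Omega> \<Longrightarrow>
    L2_inner \<Omega> (\<lambda>x. f x - g x) h = L2_inner \<Omega> f h - L2_inner \<Omega> g h"
  unfolding L2_inner_def by (simp add: left_diff_distrib L2_inner_integrable)

lemma L2_inner_zero_left: "L2_inner \<Omega> (\<lambda>x. 0) h = 0"
  by (simp add: L2_inner_def)

lemma L2_inner_sum_left:
  assumes "\<And>i. i \<in> I \<Longrightarrow> F i \<in> L2 \<Omega>" "h \<in> L2 \<Omega>"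
  shows "L2_inner \<Omega> (\<lambda>x. \<Sum>i\<in>I. F i x) h = (\<Sum>i\<in>I. L2_inner \<Omega> (F i) h)"
  using assms(1)
  by (induction I rule: infinite_finite_induct)
     (auto simp: L2_inner_zero_left L2_inner_add_left L2_sum assms(2))

lemma L2_inner_commute: "L2_inner \<Omega> g f = cnj (L2_inner \<Omega> f g)"
  unfolding L2_inner_def by (subst Bochner_Integration.integral_cnj[symmetric]) (simp add: mult.commute)

lemma L2_inner_self: "L2_inner \<Omega> f f = of_real ((L2_norm \<Omega> f)\<^sup>2)"
proof -
  have "L2_inner \<Omega> f f = (LINT x|lebesgue_on \<Omega>. of_real ((cmod (f x))\<^sup>2))"
    unfolding L2_inner_def by (simp flip: complex_norm_square)
  also have "\<dots> = of_real (LINT x|lebesgue_on \<Omega>. (cmod (f x))\<^sup>2)"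
    by (rule integral_complex_of_real)
  finally show ?thesis by (simp add: L2_norm_def)
qed

lemma L2_norm_nonneg [simp]: "0 \<le> L2_norm \<Omega> f"
  by (simp add: L2_norm_def)

lemma L2_norm_square: "(L2_norm \<Omega> f)\<^sup>2 = (LINT x|lebesgue_on \<Omega>. (cmod (f x))\<^sup>2)"
  by (simp add: L2_norm_def)

lemma L2_norm_cmult: "L2_norm \<Omega> (\<lambda>x. c * f x) = cmod c * L2_norm \<Omega> f"
  by (simp add: L2_norm_def norm_mult power_mult_distrib real_sqrt_mult)

lemma L2_norm_add_square_le:
  assumes "f \<in> L2 \<Omega>" "g \<in> L2 \<Omega>"
  shows "(L2_norm \<Omega> (\<lambda>x. f x + g x))\<^sup>2 \<le> 2 * (L2_norm \<Omega> f)\<^sup>2 + 2 * (L2_norm \<Omega> g)\<^sup>2"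
proof -
  have "(LINT x|lebesgue_on \<Omega>. (cmod (f x + g x))\<^sup>2)
      \<le> (LINT x|lebesgue_on \<Omega>. 2 * (cmod (f x))\<^sup>2 + 2 * (cmod (g x))\<^sup>2)"
    using assms by (intro integral_mono cmod_add_square_le Bochner_Integration.integrable_add
      integrable_mult_right L2_square_integrable L2_add)
  also have "\<dots> = 2 * (LINT x|lebesgue_on \<Omega>. (cmod (f x))\<^sup>2) + 2 * (LINT x|lebesgue_on \<Omega>. (cmod (g x))\<^sup>2)"
    using assms by (simp add: L2_square_integrable)
  finally show ?thesis by (simp add: L2_norm_square)
qed

text \<open>The choice \<open>s = B / A\<close> balances the two terms and gives the product. If
  \<open>A\<close> or \<open>B\<close> is zero, letting s become large or small forces z to be at
  most 0.\<close>

lemma le_mult_if_weighted_AM_GM: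
  fixes z A B :: real
  assumes "A \<ge> 0" "B \<ge> 0" and le: "\<And>s. s > 0 \<Longrightarrow> 2 * z \<le> s * A\<^sup>2 + B\<^sup>2 / s"
  shows "z \<le> A * B"
proof (cases "A > 0 \<and> B > 0")
  case True
  then show ?thesis using le[of "B / A"] by (simp add: power2_eq_square)
next
  case False
  have "z \<le> 0"
  proof (rule ccontr)
    assume "\<not> z \<le> 0"
    then have z: "z > 0" by simp
    consider "A = 0" | "B = 0" using False assms by fastforce
    then show False
    proof cases
      case 1
      have p: "B\<^sup>2 + 1 > 0" by (simp add: add_nonneg_pos)
      then have "2 * z * (B\<^sup>2 + 1) \<le> B\<^sup>2 * z"
        \<comment> \<open>With this weight the right side is
          \<open>z * B\<^sup>2 / (B\<^sup>2 + 1)\<close>, which is below z; the added 1 keeps the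
          weight positive when \<open>B\<close> is zero too. The case \<open>B = 0\<close> uses the
          reciprocal weight.\<close>
        using le[of "(B\<^sup>2 + 1) / z"] z 1 by (simp add: field_simps)
      moreover have "z * B\<^sup>2 \<ge> 0" using z by simp
      ultimately show False using z by (simp add: algebra_simps)
    next
      case 2
      have p: "A\<^sup>2 + 1 > 0" by (simp add: add_nonneg_pos)
      then have "2 * z * (A\<^sup>2 + 1) \<le> A\<^sup>2 * z"
        using le[of "z / (A\<^sup>2 + 1)"] z 2 by (simp add: field_simps)
      moreover have "z * A\<^sup>2 \<ge> 0" using z by simp
      ultimately show False using z by (simp add: algebra_simps)
    qed
  qed
  then show ?thesis using assms by (meson mult_nonneg_nonneg order_trans)
qed

text \<open>Integrating the pointwise bound \<open>2 * cmod z * cmod w \<le> s * (cmod z)\<^sup>2 +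
  (cmod w)\<^sup>2 / s\<close> for every positive s, and optimising s afterwards, covers null
  functions without normalisation.\<close>

lemma L2_Cauchy_Schwarz:
  assumes f: "f \<in> L2 \<Omega>" and g: "g \<in> L2 \<Omega>"
  shows "cmod (L2_inner \<Omega> f g) \<le> L2_norm \<Omega> f * L2_norm \<Omega> g"
proof (rule le_mult_if_weighted_AM_GM)
  fix s :: real assume s: "s > 0"
  have pt: "2 * cmod (f x * cnj (g x)) \<le> s * (cmod (f x))\<^sup>2 + (cmod (g x))\<^sup>2 / s" for x
  proof -
    have "0 \<le> (s * cmod (f x) - cmod (g x))\<^sup>2 / s" using s by simp
    also have "\<dots> = s * (cmod (f x))\<^sup>2 + (cmod (g x))\<^sup>2 / s - 2 * cmod (f x) * cmod (g x)"
      using s by (simp add: field_simps power2_eq_square)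
    finally show ?thesis by (simp add: norm_mult)
  qed
  have "2 * cmod (L2_inner \<Omega> f g) \<le> 2 * (LINT x|lebesgue_on \<Omega>. cmod (f x * cnj (g x)))"
    unfolding L2_inner_def by (intro mult_left_mono integral_norm_bound) simp
  also have "\<dots> = (LINT x|lebesgue_on \<Omega>. 2 * cmod (f x * cnj (g x)))" by simp
  also have "\<dots> \<le> (LINT x|lebesgue_on \<Omega>. s * (cmod (f x))\<^sup>2 + (cmod (g x))\<^sup>2 / s)"
    using f g by (intro integral_mono pt) (auto simp: L2_square_integrable L2_inner_integrable integrable_norm)
  also have "\<dots> = s * (L2_norm \<Omega> f)\<^sup>2 + (L2_norm \<Omega> g)\<^sup>2 / s"
    using f g by (simp add: L2_norm_square L2_square_integrable)
  finally show "2 * cmod (L2_inner \<Omega> f g) \<le> s * (L2_norm \<Omega> f)\<^sup>2 + (L2_norm \<Omega> g)\<^sup>2 / s" .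
qed auto

lemma L2_inner_cong_AE:
  assumes "f \<in> L2 \<Omega>" "g \<in> L2 \<Omega>" "h \<in> L2 \<Omega>" "AE x in lebesgue_on \<Omega>. f x = g x"
  shows "L2_inner \<Omega> f h = L2_inner \<Omega> g h"
  unfolding L2_inner_def
  using assms by (intro integral_cong_AE borel_measurable_integrable L2_inner_integrable) auto

lemma L2_inner_diff_bound:
  assumes "f \<in> L2 \<Omega>" "g \<in> L2 \<Omega>" "h \<in> L2 \<Omega>"
  shows "cmod (L2_inner \<Omega> f h - L2_inner \<Omega> g h) \<le> L2_norm \<Omega> (\<lambda>x. f x - g x) * L2_norm \<Omega> h"
  using L2_Cauchy_Schwarz[OF L2_diff[OF assms(1,2)] assms(3)] by (simp add: L2_inner_diff_left assms)

lemma L2_inner_tendsto: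
  assumes "f \<in> L2 \<Omega>" "\<And>n. F n \<in> L2 \<Omega>" "h \<in> L2 \<Omega>"
    and lim: "((\<lambda>n. L2_norm \<Omega> (\<lambda>x. f x - F n x)) \<longlongrightarrow> 0) net"
  shows "((\<lambda>n. L2_inner \<Omega> (F n) h) \<longlongrightarrow> L2_inner \<Omega> f h) net"
    and "((\<lambda>n. L2_inner \<Omega> h (F n)) \<longlongrightarrow> L2_inner \<Omega> h f) net"
proof -
  have "((\<lambda>n. L2_inner \<Omega> f h - L2_inner \<Omega> (F n) h) \<longlongrightarrow> 0) net"
  proof (rule Lim_null_comparison)
    show "((\<lambda>n. L2_norm \<Omega> (\<lambda>x. f x - F n x) * L2_norm \<Omega> h) \<longlongrightarrow> 0) net"
      using tendsto_mult_left_zero[OF lim] .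
    show "\<forall>\<^sub>F n in net. norm (L2_inner \<Omega> f h - L2_inner \<Omega> (F n) h)
        \<le> L2_norm \<Omega> (\<lambda>x. f x - F n x) * L2_norm \<Omega> h"
      by (intro always_eventually allI L2_inner_diff_bound assms)
  qed
  from tendsto_diff[OF tendsto_const this, of "L2_inner \<Omega> f h"]
  show *: "((\<lambda>n. L2_inner \<Omega> (F n) h) \<longlongrightarrow> L2_inner \<Omega> f h) net" by simp
  show "((\<lambda>n. L2_inner \<Omega> h (F n)) \<longlongrightarrow> L2_inner \<Omega> h f) net"
    unfolding L2_inner_commute[of \<Omega> h] by (intro tendsto_cnj *)
qed

section \<open>Expansion in the eigenfunctions\<close>

lemma dirichlet_eigensystem_L2:
  "dirichlet_eigensystem \<Omega> ev \<phi> \<Longrightarrow> n \<ge> 1 \<Longrightarrow> \<phi> n \<in> L2 \<Omega>"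
  by (auto simp: dirichlet_eigensystem_def numeral_2_eq_2)

text \<open>Completeness says that the partial sums converge to f in norm. Pairing them with f gives
  the sums of squares, and the inner product is continuous.\<close>

lemma parseval:
  assumes "dirichlet_eigensystem \<Omega> ev \<phi>" "f \<in> L2 \<Omega>"
  shows "(\<lambda>N. \<Sum>n=1..N. (cmod (L2_inner \<Omega> f (\<phi> n)))\<^sup>2) \<longlonglongrightarrow> (L2_norm \<Omega> f)\<^sup>2"
proof -
  let ?S = "\<lambda>N x. \<Sum>n=1..N. L2_inner \<Omega> f (\<phi> n) * \<phi> n x"
  have "(\<lambda>N. L2_norm \<Omega> (\<lambda>x. f x - ?S N x)) \<longlonglongrightarrow> 0"
    using assms by (auto simp: dirichlet_eigensystem_def)
  then have "(\<lambda>N. L2_inner \<Omega> (?S N) f) \<longlonglongrightarrow> L2_inner \<Omega> f f"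
    using assms by (intro L2_inner_tendsto L2_sum L2_cmult) (auto intro: dirichlet_eigensystem_L2)
  moreover have "L2_inner \<Omega> (?S N) f = of_real (\<Sum>n=1..N. (cmod (L2_inner \<Omega> f (\<phi> n)))\<^sup>2)" for N
  proof -
    have "L2_inner \<Omega> (?S N) f = (\<Sum>n=1..N. L2_inner \<Omega> f (\<phi> n) * L2_inner \<Omega> (\<phi> n) f)"
      using assms by (subst L2_inner_sum_left)
        (auto intro!: L2_cmult dirichlet_eigensystem_L2 sum.cong simp: L2_inner_cmult_left)
    also have "\<dots> = (\<Sum>n=1..N. of_real ((cmod (L2_inner \<Omega> f (\<phi> n)))\<^sup>2))"
      by (intro sum.cong refl) (subst complex_norm_square, subst (2) L2_inner_commute, rule refl)
    finally show ?thesis by simp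
  qed
  ultimately have "(\<lambda>N. of_real (\<Sum>n=1..N. (cmod (L2_inner \<Omega> f (\<phi> n)))\<^sup>2) :: complex) \<longlonglongrightarrow>
      of_real ((L2_norm \<Omega> f)\<^sup>2)"
    by (simp add: L2_inner_self)
  then show ?thesis by (simp only: tendsto_of_real_iff)
qed

lemma bessel:
  assumes "dirichlet_eigensystem \<Omega> ev \<phi>" "f \<in> L2 \<Omega>"
  shows "(\<Sum>n=1..N. (cmod (L2_inner \<Omega> f (\<phi> n)))\<^sup>2) \<le> (L2_norm \<Omega> f)\<^sup>2"
proof (rule incseq_le[OF _ parseval[OF assms]])
  show "incseq (\<lambda>N. \<Sum>n=1..N. (cmod (L2_inner \<Omega> f (\<phi> n)))\<^sup>2)"
    by (intro incseq_SucI) simp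
qed

subsection \<open>Integration by parts for test functions\<close>

text \<open>The mean value inequality along a segment. It supplies a majorant of the difference
  quotients that does not depend on the step, as dominated convergence requires.\<close>

lemma translated_difference_bound:
  fixes \<psi> :: "'a::euclidean_space \<Rightarrow> complex"
  assumes "Ck (Suc 0) \<psi>" "\<And>x. norm (pderiv_dir b \<psi> x) \<le> B" "h > 0"
  shows "norm (\<psi> (x + h *\<^sub>R b) - \<psi> x) \<le> B * h"
proof -
  have der: "((\<lambda>t. \<psi> (x + t *\<^sub>R b)) has_derivative (\<lambda>s. s *\<^sub>R pderiv_dir b \<psi> (x + t *\<^sub>R b))) (at t)" for t
  proof -
    note D = Ck_has_derivative[OF assms(1), of "x + t *\<^sub>R b"]
    have "((\<lambda>t. x + t *\<^sub>R b) has_derivative (\<lambda>s. s *\<^sub>R b)) (at t)"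
      by (auto intro!: derivative_eq_intros)
    from has_derivative_compose[OF this D] show ?thesis
      by (simp only: linear_scale[OF has_derivative_linear[OF D]])
  qed
  have "\<exists>t\<in>{0<..<h}. norm (\<psi> (x + h *\<^sub>R b) - \<psi> (x + 0 *\<^sub>R b)) \<le> norm ((h - 0) *\<^sub>R pderiv_dir b \<psi> (x + t *\<^sub>R b))"
  proof (rule mvt_general[where f="\<lambda>t. \<psi> (x + t *\<^sub>R b)"])
    show "continuous_on {0..h} (\<lambda>t. \<psi> (x + t *\<^sub>R b))"
      using der by (intro has_derivative_continuous_on) (rule has_derivative_at_withinI)
  qed (use \<open>h > 0\<close> der in auto)
  then obtain t where "norm (\<psi> (x + h *\<^sub>R b) - \<psi> x) \<le> h * norm (pderiv_dir b \<psi> (x + t *\<^sub>R b))"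
    using \<open>h > 0\<close> by auto
  also have "\<dots> \<le> h * B" using assms by (intro mult_left_mono) auto
  finally show ?thesis by (simp add: mult.commute)
qed

lemma difference_quotient_tendsto:
  fixes \<psi> :: "'a::euclidean_space \<Rightarrow> complex"
  assumes "Ck (Suc 0) \<psi>" "b \<in> Basis"
  shows "(\<lambda>n. real (Suc n) *\<^sub>R (\<psi> (x + inverse (real (Suc n)) *\<^sub>R b) - \<psi> x)) \<longlonglongrightarrow> pderiv_dir b \<psi> x"
proof -
  note D = Ck_has_derivative[OF assms(1), of x]
  define h where "h n = inverse (real (Suc n)) *\<^sub>R b" for n
  have nh: "norm (h n) = inverse (real (Suc n))" for n
    using assms(2) by (simp add: h_def)
  have "h \<longlonglongrightarrow> 0 *\<^sub>R b"
    unfolding h_def by (intro tendsto_intros LIMSEQ_inverse_real_of_nat)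
  moreover have "h n \<noteq> 0" for n using nh[of n] by auto
  ultimately have "filterlim h (at 0) sequentially"
    by (auto simp: filterlim_at)
  then have lim: "(\<lambda>n. norm (\<psi> (x + h n) - \<psi> x - pderiv_dir (h n) \<psi> x) / norm (h n)) \<longlonglongrightarrow> 0"
    by (rule filterlim_compose[OF conjunct2[OF D[unfolded has_derivative_at]]])
  have eq: "norm (\<psi> (x + h n) - \<psi> x - pderiv_dir (h n) \<psi> x) / norm (h n)
      = norm (real (Suc n) *\<^sub>R (\<psi> (x + inverse (real (Suc n)) *\<^sub>R b) - \<psi> x) - pderiv_dir b \<psi> x)" for n
  proof -
    have "pderiv_dir (h n) \<psi> x = inverse (real (Suc n)) *\<^sub>R pderiv_dir b \<psi> x"
      unfolding h_def by (rule linear_scale[OF has_derivative_linear[OF D]])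
    then have "real (Suc n) *\<^sub>R (\<psi> (x + h n) - \<psi> x) - pderiv_dir b \<psi> x
       = real (Suc n) *\<^sub>R (\<psi> (x + h n) - \<psi> x - pderiv_dir (h n) \<psi> x)"
      by (simp add: scaleR_diff_right del: of_nat_Suc)
    then have "norm (real (Suc n) *\<^sub>R (\<psi> (x + h n) - \<psi> x) - pderiv_dir b \<psi> x)
        = real (Suc n) * norm (\<psi> (x + h n) - \<psi> x - pderiv_dir (h n) \<psi> x)"
      by (simp only: norm_scaleR)
    then show ?thesis unfolding nh h_def[symmetric] by (simp add: divide_inverse)
  qed
  from lim have "(\<lambda>n. norm (real (Suc n) *\<^sub>R (\<psi> (x + inverse (real (Suc n)) *\<^sub>R b) - \<psi> x) - pderiv_dir b \<psi> x)) \<longlonglongrightarrow> 0"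
    unfolding eq .
  then show ?thesis
    by (rule LIM_zero_cancel[OF tendsto_norm_zero_cancel])
qed

lemma borel_measurable_test_function:
  "test_function \<Omega> \<psi> \<Longrightarrow> \<psi> \<in> borel_measurable borel"
  by (intro borel_measurable_continuous_onI Ck_imp_continuous test_function_Ck)

lemma integrable_lborel_compact_support:
  fixes f :: "'a::euclidean_space \<Rightarrow> complex"
  assumes "f \<in> borel_measurable borel" "\<And>x. norm (f x) \<le> B * indicator (cball 0 r) x"
  shows "integrable lborel f"
proof (rule Bochner_Integration.integrable_bound)
  show "integrable lborel (\<lambda>x. B * indicator (cball 0 r) x :: real)"
    using emeasure_bounded_finite[OF bounded_cball]
    by (intro integrable_mult_right integrable_real_indicator) auto
  show "AE x in lborel. norm (f x) \<le> norm (B * indicator (cball 0 r) x :: real)"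
    using order_trans[OF assms(2) abs_ge_self] by simp
qed (use assms in simp)

text \<open>By translation invariance every difference quotient has integral zero. The quotients
  converge pointwise to the derivative, are uniformly bounded and live in a common ball.\<close>

lemma integral_pderiv_dir_test_function:
  fixes \<psi> :: "'a::euclidean_space \<Rightarrow> complex"
  assumes \<psi>: "test_function \<Omega> \<psi>" and b: "b \<in> Basis"
  shows "(LINT x|lborel. pderiv_dir b \<psi> x) = 0"
proof -
  define h where "h n = inverse (real (Suc n))" for n
  define s where "s n x = real (Suc n) *\<^sub>R (\<psi> (x + h n *\<^sub>R b) - \<psi> x)" for n x
  have h: "h n > 0" "h n \<le> 1" for n by (auto simp: h_def field_simps)
  obtain B0 where B0: "B0 \<ge> 0" "\<And>x. norm (\<psi> x) \<le> B0" using test_function_bounded[OF \<psi>] by blast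
  obtain B where B: "B \<ge> 0" "\<And>x. norm (pderiv_dir b \<psi> x) \<le> B"
    using test_function_bounded[OF test_function_pderiv_dir[OF \<psi> b]] by blast
  have "bounded (closure {x. \<psi> x \<noteq> 0})" using \<psi> by (auto simp: test_function_def compact_imp_bounded)
  then obtain r where "\<And>x. x \<in> closure {x. \<psi> x \<noteq> 0} \<Longrightarrow> norm x \<le> r"
    by (auto simp: bounded_iff)
  then have r: "\<psi> x = 0" if "norm x > r" for x
    using eq_0_outside_support[of x \<psi>] that by fastforce
  have meas: "\<psi> \<in> borel_measurable borel" "pderiv_dir b \<psi> \<in> borel_measurable borel"
    using borel_measurable_test_function[OF \<psi>]
      borel_measurable_test_function[OF test_function_pderiv_dir[OF \<psi> b]] .
  have int: "integrable lborel \<psi>"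
    by (rule integrable_lborel_compact_support[of _ B0 r]) (use meas B0 r in \<open>auto simp: indicator_def not_le\<close>)
  have meas_shift: "(\<lambda>x. \<psi> (x + c)) \<in> borel_measurable borel" for c
    using meas(1) by measurable
  have shift: "integrable lborel (\<lambda>x. \<psi> (x + c))" "(LINT x|lborel. \<psi> (x + c)) = (LINT x|lborel. \<psi> x)" for c
    using integrable_distr_eq[of "(+) c" lborel borel \<psi>] integral_distr[of "(+) c" lborel borel \<psi>] int meas(1)
    by (simp_all add: lborel_distr_plus add.commute)
  \<comment> \<open>The support lies in the ball of radius \<open>r\<close>, and the shifts have
    length at most 1, so the ball of radius \<open>r + 1\<close> contains the supports of all
    quotients.\<close>
  have "(\<lambda>n. LINT x|lborel. s n x) \<longlonglongrightarrow> (LINT x|lborel. pderiv_dir b \<psi> x)"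
  proof (rule integral_dominated_convergence[where w="\<lambda>x. B * indicator (cball 0 (r + 1)) x"])
    show "integrable lborel (\<lambda>x. B * indicator (cball 0 (r + 1)) x :: real)"
      using emeasure_bounded_finite[OF bounded_cball]
      by (intro integrable_mult_right integrable_real_indicator) auto
    show "AE x in lborel. (\<lambda>n. s n x) \<longlonglongrightarrow> pderiv_dir b \<psi> x"
      unfolding s_def h_def using difference_quotient_tendsto[OF test_function_Ck[OF \<psi>] b] by simp
    fix n
    show "s n \<in> borel_measurable lborel"
      unfolding s_def using meas_shift[of "h n *\<^sub>R b"] meas(1) by simp
    have "norm (s n x) \<le> B * indicator (cball 0 (r + 1)) x" for x
    proof (cases "norm x \<le> r + 1")
      case True
      have "norm (s n x) = real (Suc n) * norm (\<psi> (x + h n *\<^sub>R b) - \<psi> x)"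
        unfolding s_def by simp
      also have "\<dots> \<le> real (Suc n) * (B * h n)"
        using h by (intro mult_left_mono translated_difference_bound test_function_Ck[OF \<psi>] B) auto
      also have "\<dots> = B" by (simp add: h_def)
      finally show ?thesis using True by simp
    next
      case False
      have "norm x \<le> norm (x + h n *\<^sub>R b) + norm (h n *\<^sub>R b)"
        using norm_triangle_ineq4[of "x + h n *\<^sub>R b" "h n *\<^sub>R b"] by simp
      then have "norm x \<le> norm (x + h n *\<^sub>R b) + 1"
        using h[of n] b by simp
      then have "\<psi> (x + h n *\<^sub>R b) = 0" "\<psi> x = 0" using False by (auto intro: r)
      then show ?thesis using False by (simp add: s_def)
    qed
    then show "AE x in lborel. norm (s n x) \<le> B * indicator (cball 0 (r + 1)) x" by simp
  qed (use meas in simp)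
  moreover have "(LINT x|lborel. s n x) = 0" for n
    unfolding s_def using shift int by simp
  ultimately show ?thesis by (simp add: LIMSEQ_const_iff)
qed

text \<open>Carries integrals over the domain to the whole space, where translation invariance is
  available.\<close>

lemma lebesgue_on_integral_eq_lborel:
  fixes f :: "'a::euclidean_space \<Rightarrow> complex"
  assumes "open \<Omega>" "f \<in> borel_measurable borel" "\<And>x. x \<notin> \<Omega> \<Longrightarrow> f x = 0"
  shows "(LINT x|lebesgue_on \<Omega>. f x) = (LINT x|lborel. f x)"
proof -
  have "(LINT x|lebesgue_on \<Omega>. f x) = (LINT x|lebesgue. indicator \<Omega> x *\<^sub>R f x)"
    using assms(1) by (intro integral_restrict_space) (simp add: borel_open)
  also have "(\<lambda>x. indicator \<Omega> x *\<^sub>R f x) = f"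
    using assms(3) by (auto simp: indicator_def)
  also have "(LINT x|lebesgue. f x) = (LINT x|lborel. f x)"
    using assms(2) by (intro integral_completion) simp
  finally show ?thesis .
qed

lemma test_function_L2:
  assumes "open \<Omega>" "bounded \<Omega>" "test_function \<Omega> \<psi>"
  shows "\<psi> \<in> L2 \<Omega>"
proof -
  obtain B where B: "B \<ge> 0" "\<And>x. norm (\<psi> x) \<le> B" using test_function_bounded[OF assms(3)] by blast
  interpret finite_measure "lebesgue_on \<Omega>"
    by (intro finite_measure_lebesgue_on lmeasurable_open assms)
  have m: "\<psi> \<in> borel_measurable (lebesgue_on \<Omega>)"
    using continuous_on_subset[OF Ck_imp_continuous[OF test_function_Ck[OF assms(3), of 0]] subset_UNIV]
    by (rule continuous_imp_measurable_on_sets_lebesgue) (simp add: borel_open assms(1))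
  have "integrable (lebesgue_on \<Omega>) (\<lambda>x. (cmod (\<psi> x))\<^sup>2)"
    using B m by (intro integrable_const_bound[of _ "B\<^sup>2"]) auto
  then show ?thesis using m by (simp add: L2_def)
qed

text \<open>The product of two test functions is a test function, so its derivative integrates to
  zero; the product rule splits that integral.\<close>

lemma test_function_has_weak_pderiv:
  assumes "open \<Omega>" "bounded \<Omega>" "b \<in> Basis" "test_function \<Omega> \<psi>"
  shows "has_weak_pderiv \<Omega> b \<psi> (pderiv_dir b \<psi>)"
  unfolding has_weak_pderiv_def
proof (intro allI impI)
  fix \<zeta> :: "'a \<Rightarrow> complex" assume \<zeta>: "test_function \<Omega> \<zeta>"
  note \<psi> = assms(4)
  have t: "test_function \<Omega> (\<lambda>x. \<psi> x * \<zeta> x)"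
    by (intro test_function_mult \<psi> test_function_Ck[OF \<zeta>])
  have L: "\<psi> \<in> L2 \<Omega>" "\<zeta> \<in> L2 \<Omega>" "pderiv_dir b \<psi> \<in> L2 \<Omega>" "pderiv_dir b \<zeta> \<in> L2 \<Omega>"
    by (intro test_function_L2 test_function_pderiv_dir assms \<zeta>)+
  note td = test_function_pderiv_dir[OF t assms(3)]
  have "0 = (LINT x|lebesgue_on \<Omega>. pderiv_dir b (\<lambda>x. \<psi> x * \<zeta> x) x)"
    using lebesgue_on_integral_eq_lborel[OF assms(1) borel_measurable_test_function[OF td] test_function_outside[OF td]]
      integral_pderiv_dir_test_function[OF t assms(3)] by simp
  also have "\<dots> = (LINT x|lebesgue_on \<Omega>. \<psi> x * pderiv_dir b \<zeta> x + pderiv_dir b \<psi> x * \<zeta> x)"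
    by (subst pderiv_dir_mult[OF test_function_Ck[OF \<psi>] test_function_Ck[OF \<zeta>]]) (rule refl)
  also have "\<dots> = (LINT x|lebesgue_on \<Omega>. \<psi> x * pderiv_dir b \<zeta> x) + (LINT x|lebesgue_on \<Omega>. pderiv_dir b \<psi> x * \<zeta> x)"
    using L by (simp add: L2_mult_integrable)
  finally show "(LINT x|lebesgue_on \<Omega>. \<psi> x * pderiv_dir b \<zeta> x) = - (LINT x|lebesgue_on \<Omega>. pderiv_dir b \<psi> x * \<zeta> x)"
    by (simp add: eq_neg_iff_add_eq_0)
qed

subsection \<open>Green's formula for the Dirichlet Laplacian\<close>

text \<open>Functions are representatives and weak derivatives are chosen only up to null sets, so
  identity in \<open>L2\<close> is expressed by a difference of seminorm zero.\<close>

lemma L2_inner_eq_if_null_left: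
  assumes "v \<in> L2 \<Omega>" "w \<in> L2 \<Omega>" "h \<in> L2 \<Omega>" "L2_norm \<Omega> (\<lambda>x. v x - w x) = 0"
  shows "L2_inner \<Omega> v h = L2_inner \<Omega> w h"
  using L2_inner_diff_bound[OF assms(1-3)] assms(4) by simp

lemma L2_norm_eq_if_null:
  assumes "v \<in> L2 \<Omega>" "w \<in> L2 \<Omega>" "L2_norm \<Omega> (\<lambda>x. v x - w x) = 0"
  shows "L2_norm \<Omega> v = L2_norm \<Omega> w"
proof -
  have "L2_inner \<Omega> v v = L2_inner \<Omega> w v" "L2_inner \<Omega> v w = L2_inner \<Omega> w w"
    using assms by (auto intro: L2_inner_eq_if_null_left)
  then have "complex_of_real ((L2_norm \<Omega> v)\<^sup>2) = complex_of_real ((L2_norm \<Omega> w)\<^sup>2)"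
    unfolding L2_inner_self by (metis L2_inner_commute complex_cnj_complex_of_real)
  then show ?thesis by (simp only: of_real_eq_iff power2_eq_iff_nonneg L2_norm_nonneg)
qed

lemma L2_norm_triangle:
  assumes f: "f \<in> L2 \<Omega>" and g: "g \<in> L2 \<Omega>"
  shows "L2_norm \<Omega> (\<lambda>x. f x + g x) \<le> L2_norm \<Omega> f + L2_norm \<Omega> g"
proof -
  let ?h = "\<lambda>x. f x + g x"
  note h = L2_add[OF f g]
  have "(L2_norm \<Omega> ?h)\<^sup>2 = cmod (L2_inner \<Omega> ?h ?h)"
    by (simp only: L2_inner_self norm_of_real) simp
  also have "\<dots> \<le> cmod (L2_inner \<Omega> f ?h) + cmod (L2_inner \<Omega> g ?h)"
    unfolding L2_inner_add_left[OF f g h] by (rule norm_triangle_ineq)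
  also have "\<dots> \<le> (L2_norm \<Omega> f + L2_norm \<Omega> g) * L2_norm \<Omega> ?h"
    using L2_Cauchy_Schwarz[OF f h] L2_Cauchy_Schwarz[OF g h] by (simp add: distrib_right)
  finally have *: "L2_norm \<Omega> ?h * L2_norm \<Omega> ?h \<le> (L2_norm \<Omega> f + L2_norm \<Omega> g) * L2_norm \<Omega> ?h"
    by (simp add: power2_eq_square)
  show ?thesis
  proof (cases "L2_norm \<Omega> ?h = 0")
    case False
    then have "L2_norm \<Omega> ?h > 0" using L2_norm_nonneg[of \<Omega> ?h] by linarith
    with * show ?thesis by (rule mult_right_le_imp_le)
  qed simp
qed

lemma L2_norm_sum_le:
  "(\<And>i. i \<in> I \<Longrightarrow> F i \<in> L2 \<Omega>) \<Longrightarrow> L2_norm \<Omega> (\<lambda>x. \<Sum>i\<in>I. F i x) \<le> (\<Sum>i\<in>I. L2_norm \<Omega> (F i))"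
proof (induction I rule: infinite_finite_induct)
  case (insert i I)
  then show ?case
    using order_trans[OF L2_norm_triangle[of "F i" \<Omega> "\<lambda>x. \<Sum>i\<in>I. F i x"]] by (simp add: L2_sum)
qed (simp_all add: L2_norm_def)

section \<open>Weak derivatives and the Laplacian in Sobolev spaces\<close>

lemma weak_pderiv_spec:
  assumes "v \<in> L2 \<Omega>" "has_weak_pderiv \<Omega> b u v"
  shows "weak_pderiv \<Omega> b u \<in> L2 \<Omega>" "has_weak_pderiv \<Omega> b u (weak_pderiv \<Omega> b u)"
  using someI[of "\<lambda>v. v \<in> L2 \<Omega> \<and> has_weak_pderiv \<Omega> b u v" v] assms
  by (auto simp: weak_pderiv_def)

lemma sobolev_imp_L2: "u \<in> sobolev k \<Omega> \<Longrightarrow> u \<in> L2 \<Omega>"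
  by (cases k) auto

lemma sobolev_Suc_weak_pderiv:
  assumes "u \<in> sobolev (Suc k) \<Omega>" "b \<in> Basis"
  shows "weak_pderiv \<Omega> b u \<in> L2 \<Omega>" "has_weak_pderiv \<Omega> b u (weak_pderiv \<Omega> b u)"
proof -
  obtain v where "v \<in> sobolev k \<Omega>" "has_weak_pderiv \<Omega> b u v" using assms by auto
  then show "weak_pderiv \<Omega> b u \<in> L2 \<Omega>" "has_weak_pderiv \<Omega> b u (weak_pderiv \<Omega> b u)"
    using weak_pderiv_spec sobolev_imp_L2 by blast+
qed

text \<open>The derivative chosen by \<open>weak_pderiv\<close> need not be the one known to be weakly differentiable,
  but both have the same integrals against derivatives of test functions.\<close>

lemma sobolev_2_weak_pderiv:
  assumes u: "u \<in> sobolev 2 \<Omega>" and b: "b \<in> Basis"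
  shows "weak_pderiv \<Omega> b (weak_pderiv \<Omega> b u) \<in> L2 \<Omega>"
    and "has_weak_pderiv \<Omega> b (weak_pderiv \<Omega> b u) (weak_pderiv \<Omega> b (weak_pderiv \<Omega> b u))"
proof -
  obtain v where v: "v \<in> sobolev 1 \<Omega>" "has_weak_pderiv \<Omega> b u v"
    using u b by (auto simp: numeral_2_eq_2)
  obtain w where w: "w \<in> L2 \<Omega>" "has_weak_pderiv \<Omega> b v w"
    using v b by auto
  have u1: "has_weak_pderiv \<Omega> b u (weak_pderiv \<Omega> b u)"
    using sobolev_Suc_weak_pderiv(2)[of u 1] u b by (simp add: numeral_2_eq_2)
  have "has_weak_pderiv \<Omega> b (weak_pderiv \<Omega> b u) w"
    unfolding has_weak_pderiv_def
  proof (intro allI impI)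
    fix \<psi> :: "'a \<Rightarrow> complex" assume \<psi>: "test_function \<Omega> \<psi>"
    have "- (LINT x|lebesgue_on \<Omega>. weak_pderiv \<Omega> b u x * pderiv_dir b \<psi> x)
        = - (LINT x|lebesgue_on \<Omega>. v x * pderiv_dir b \<psi> x)"
      using u1 v(2) test_function_pderiv_dir[OF \<psi> b] by (simp add: has_weak_pderiv_def)
    then show "(LINT x|lebesgue_on \<Omega>. weak_pderiv \<Omega> b u x * pderiv_dir b \<psi> x)
        = - (LINT x|lebesgue_on \<Omega>. w x * \<psi> x)"
      using w(2) \<psi> by (simp add: has_weak_pderiv_def)
  qed
  then show "weak_pderiv \<Omega> b (weak_pderiv \<Omega> b u) \<in> L2 \<Omega>"
    "has_weak_pderiv \<Omega> b (weak_pderiv \<Omega> b u) (weak_pderiv \<Omega> b (weak_pderiv \<Omega> b u))"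
    using weak_pderiv_spec w(1) by blast+
qed

lemma laplacian_L2: "u \<in> sobolev 2 \<Omega> \<Longrightarrow> laplacian \<Omega> u \<in> L2 \<Omega>"
  unfolding laplacian_def by (intro L2_sum sobolev_2_weak_pderiv)

lemma L2_norm_le_sobolev_norm: "L2_norm \<Omega> u \<le> sobolev_norm k \<Omega> u"
  by (cases k) (auto intro!: real_le_rsqrt sum_nonneg)

lemma weak_pderiv_le_sobolev_norm:
  assumes "b \<in> Basis"
  shows "sobolev_norm k \<Omega> (weak_pderiv \<Omega> b u) \<le> sobolev_norm (Suc k) \<Omega> u"
proof -
  have "(sobolev_norm k \<Omega> (weak_pderiv \<Omega> b u))\<^sup>2 \<le> (\<Sum>b\<in>Basis. (sobolev_norm k \<Omega> (weak_pderiv \<Omega> b u))\<^sup>2)"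
    using assms by (intro member_le_sum) auto
  then show ?thesis by (auto intro!: real_le_rsqrt add_increasing)
qed

text \<open>Each pure second derivative is one of the terms of the Sobolev norm, and there are
  \<open>DIM('a)\<close> of them. This is where the dimension enters the stability constant.\<close>

lemma laplacian_norm_le:
  fixes u :: "'a::euclidean_space \<Rightarrow> complex"
  assumes "u \<in> sobolev 2 \<Omega>"
  shows "L2_norm \<Omega> (laplacian \<Omega> u) \<le> DIM('a) * sobolev_norm 2 \<Omega> u"
proof -
  have "L2_norm \<Omega> (laplacian \<Omega> u) \<le> (\<Sum>b\<in>Basis. L2_norm \<Omega> (weak_pderiv \<Omega> b (weak_pderiv \<Omega> b u)))"
    unfolding laplacian_def by (intro L2_norm_sum_le sobolev_2_weak_pderiv assms)
  also have "\<dots> \<le> (\<Sum>b\<in>(Basis::'a set). sobolev_norm 2 \<Omega> u)"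
  proof (rule sum_mono)
    fix b :: 'a assume b: "b \<in> Basis"
    have "L2_norm \<Omega> (weak_pderiv \<Omega> b (weak_pderiv \<Omega> b u)) \<le> sobolev_norm 1 \<Omega> (weak_pderiv \<Omega> b u)"
      using weak_pderiv_le_sobolev_norm[OF b, of 0] by simp
    also have "\<dots> \<le> sobolev_norm 2 \<Omega> u"
      using weak_pderiv_le_sobolev_norm[OF b, of 1] by (simp only: Suc_1)
    finally show "L2_norm \<Omega> (weak_pderiv \<Omega> b (weak_pderiv \<Omega> b u)) \<le> sobolev_norm 2 \<Omega> u" .
  qed
  finally show ?thesis by simp
qed

locale bounded_domain_eigensystem =
  fixes \<Omega> :: "'a::euclidean_space set" and ev :: "nat \<Rightarrow> real" and \<phi> :: "nat \<Rightarrow> 'a \<Rightarrow> complex"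
  assumes open_domain: "open \<Omega>" and bounded_domain: "bounded \<Omega>"
    and eigensystem: "dirichlet_eigensystem \<Omega> ev \<phi>"
begin

lemmas test_L2 = test_function_L2[OF open_domain bounded_domain]
lemmas \<phi>_L2 = dirichlet_eigensystem_L2[OF eigensystem]

lemma ev_pos: "n \<ge> 1 \<Longrightarrow> ev n > 0"
  and ev_le_Suc: "n \<ge> 1 \<Longrightarrow> ev n \<le> ev (Suc n)"
  and \<phi>_H2: "n \<ge> 1 \<Longrightarrow> \<phi> n \<in> sobolev 2 \<Omega>"
  and \<phi>_H10: "n \<ge> 1 \<Longrightarrow> \<phi> n \<in> H10 \<Omega>"
  and laplacian_\<phi>: "n \<ge> 1 \<Longrightarrow> AE x in lebesgue_on \<Omega>. - laplacian \<Omega> (\<phi> n) x = of_real (ev n) * \<phi> n x"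
  using eigensystem by (auto simp: dirichlet_eigensystem_def)

text \<open>Since the eigenfunctions lie in \<open>H10\<close> and span \<open>L2\<close>, the test functions are dense in \<open>L2\<close>.\<close>

lemma L2_null_if_orthogonal_test:
  assumes v: "v \<in> L2 \<Omega>" and orth: "\<And>\<psi>. test_function \<Omega> \<psi> \<Longrightarrow> (LINT x|lebesgue_on \<Omega>. v x * \<psi> x) = 0"
  shows "L2_norm \<Omega> v = 0"
proof -
  have "L2_inner \<Omega> v (\<phi> n) = 0" if n: "n \<ge> 1" for n
  proof -
    obtain \<psi> where \<psi>: "\<And>k. test_function \<Omega> (\<psi> k)"
      and lim: "(\<lambda>k. sobolev_norm 1 \<Omega> (\<lambda>x. \<phi> n x - \<psi> k x)) \<longlonglongrightarrow> 0"
      using \<phi>_H10[OF n] by (auto simp: H10_def)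
    have "(\<lambda>k. L2_norm \<Omega> (\<lambda>x. \<phi> n x - \<psi> k x)) \<longlonglongrightarrow> 0"
      by (rule tendsto_sandwich[OF _ _ tendsto_const lim]) (simp_all only: L2_norm_le_sobolev_norm L2_norm_nonneg eventually_True)
    then have "(\<lambda>k. L2_inner \<Omega> v (\<psi> k)) \<longlonglongrightarrow> L2_inner \<Omega> v (\<phi> n)"
      by (rule L2_inner_tendsto(2)[OF \<phi>_L2[OF n] test_L2[OF \<psi>] v])
    moreover have "L2_inner \<Omega> v (\<psi> k) = 0" for k
      unfolding L2_inner_def by (rule orth[OF test_function_linear[OF \<psi> bounded_linear_cnj]])
    ultimately show ?thesis by (simp add: LIMSEQ_const_iff)
  qed
  then have "(\<lambda>N. 0) \<longlonglongrightarrow> (L2_norm \<Omega> v)\<^sup>2"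
    using parseval[OF eigensystem v] by simp
  then show ?thesis by (simp add: LIMSEQ_const_iff)
qed

text \<open>The difference of two weak derivatives annihilates all test functions.\<close>

lemma weak_pderiv_unique:
  assumes "v \<in> L2 \<Omega>" "w \<in> L2 \<Omega>" "has_weak_pderiv \<Omega> b u v" "has_weak_pderiv \<Omega> b u w"
  shows "L2_norm \<Omega> (\<lambda>x. v x - w x) = 0"
proof (rule L2_null_if_orthogonal_test[OF L2_diff[OF assms(1,2)]])
  fix \<psi> :: "'a \<Rightarrow> complex" assume \<psi>: "test_function \<Omega> \<psi>"
  have "(LINT x|lebesgue_on \<Omega>. (v x - w x) * \<psi> x)
      = (LINT x|lebesgue_on \<Omega>. v x * \<psi> x) - (LINT x|lebesgue_on \<Omega>. w x * \<psi> x)"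
    using L2_mult_integrable[OF _ test_L2[OF \<psi>]] assms by (simp add: left_diff_distrib)
  also have "(LINT x|lebesgue_on \<Omega>. v x * \<psi> x) = - (LINT x|lebesgue_on \<Omega>. u x * pderiv_dir b \<psi> x)"
    using assms(3) \<psi> by (simp add: has_weak_pderiv_def)
  also have "(LINT x|lebesgue_on \<Omega>. w x * \<psi> x) = - (LINT x|lebesgue_on \<Omega>. u x * pderiv_dir b \<psi> x)"
    using assms(4) \<psi> by (simp add: has_weak_pderiv_def)
  finally show "(LINT x|lebesgue_on \<Omega>. (v x - w x) * \<psi> x) = 0" by simp
qed

lemma has_weak_pderiv_diff:
  assumes "u \<in> L2 \<Omega>" "u' \<in> L2 \<Omega>" "v \<in> L2 \<Omega>" "v' \<in> L2 \<Omega>" "b \<in> Basis"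
    "has_weak_pderiv \<Omega> b u v" "has_weak_pderiv \<Omega> b u' v'"
  shows "has_weak_pderiv \<Omega> b (\<lambda>x. u x - u' x) (\<lambda>x. v x - v' x)"
  unfolding has_weak_pderiv_def
proof (intro allI impI)
  fix \<psi> :: "'a \<Rightarrow> complex" assume \<psi>: "test_function \<Omega> \<psi>"
  show "(LINT x|lebesgue_on \<Omega>. (u x - u' x) * pderiv_dir b \<psi> x) = - (LINT x|lebesgue_on \<Omega>. (v x - v' x) * \<psi> x)"
    using assms \<psi> L2_mult_integrable[OF _ test_L2[OF \<psi>]]
      L2_mult_integrable[OF _ test_L2[OF test_function_pderiv_dir[OF \<psi> assms(5)]]]
    by (simp add: left_diff_distrib has_weak_pderiv_def)
qed

text \<open>The Sobolev norm controls the weak derivative chosen for the difference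
  \<open>u x - \<psi> n x\<close>, not the difference of the derivatives. By uniqueness both have
  the same norm, and the derivative of the test function may be taken in the classical
  sense.\<close>

lemma H10_approx:
  assumes u: "u \<in> H10 \<Omega>"
  obtains \<psi> where "\<And>n. test_function \<Omega> (\<psi> n)"
    and "(\<lambda>n. L2_norm \<Omega> (\<lambda>x. u x - \<psi> n x)) \<longlonglongrightarrow> 0"
    and "\<And>b. b \<in> Basis \<Longrightarrow> (\<lambda>n. L2_norm \<Omega> (\<lambda>x. weak_pderiv \<Omega> b u x - pderiv_dir b (\<psi> n) x)) \<longlonglongrightarrow> 0"
proof -
  have u1: "u \<in> sobolev (Suc 0) \<Omega>" using u by (simp add: H10_def)
  obtain \<psi> where \<psi>: "\<And>k. test_function \<Omega> (\<psi> k)"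
    and lim: "(\<lambda>k. sobolev_norm 1 \<Omega> (\<lambda>x. u x - \<psi> k x)) \<longlonglongrightarrow> 0"
    using u by (auto simp: H10_def)
  show ?thesis
  proof (rule that[OF \<psi>])
    show "(\<lambda>n. L2_norm \<Omega> (\<lambda>x. u x - \<psi> n x)) \<longlonglongrightarrow> 0"
      by (rule tendsto_sandwich[OF _ _ tendsto_const lim]) (simp_all only: L2_norm_le_sobolev_norm L2_norm_nonneg eventually_True)
    fix b :: 'a assume b: "b \<in> Basis"
    show "(\<lambda>n. L2_norm \<Omega> (\<lambda>x. weak_pderiv \<Omega> b u x - pderiv_dir b (\<psi> n) x)) \<longlonglongrightarrow> 0"
    proof (rule tendsto_sandwich[OF _ _ tendsto_const lim])
      have "L2_norm \<Omega> (\<lambda>x. weak_pderiv \<Omega> b u x - pderiv_dir b (\<psi> n) x)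
          \<le> sobolev_norm 1 \<Omega> (\<lambda>x. u x - \<psi> n x)" for n
      proof -
        let ?d = "\<lambda>x. weak_pderiv \<Omega> b u x - pderiv_dir b (\<psi> n) x" and ?r = "weak_pderiv \<Omega> b (\<lambda>x. u x - \<psi> n x)"
        have L: "?d \<in> L2 \<Omega>"
          by (intro L2_diff sobolev_Suc_weak_pderiv[OF u1 b] test_L2 test_function_pderiv_dir \<psi> b)
        have W: "has_weak_pderiv \<Omega> b (\<lambda>x. u x - \<psi> n x) ?d"
          by (intro has_weak_pderiv_diff sobolev_Suc_weak_pderiv[OF u1 b] test_L2 test_function_pderiv_dir \<psi> b
              sobolev_imp_L2[OF u1] test_function_has_weak_pderiv open_domain bounded_domain)
        have "L2_norm \<Omega> ?d = L2_norm \<Omega> ?r"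
          by (intro L2_norm_eq_if_null L weak_pderiv_unique[OF L weak_pderiv_spec(1)[OF L W] W]
              weak_pderiv_spec[OF L W])
        also have "\<dots> \<le> sobolev_norm 1 \<Omega> (\<lambda>x. u x - \<psi> n x)"
          using weak_pderiv_le_sobolev_norm[OF b, of 0] by simp
        finally show ?thesis .
      qed
      then show "\<forall>\<^sub>F n in sequentially. L2_norm \<Omega> (\<lambda>x. weak_pderiv \<Omega> b u x - pderiv_dir b (\<psi> n) x)
          \<le> sobolev_norm 1 \<Omega> (\<lambda>x. u x - \<psi> n x)" by simp
    qed simp
  qed
qed

text \<open>For a test function in place of u this is the definition of a weak derivative.
  Approximating u and its derivative simultaneously extends it to \<open>H10\<close>.\<close>

lemma weak_pderiv_by_parts:
  assumes w: "w \<in> L2 \<Omega>" "w' \<in> L2 \<Omega>" "has_weak_pderiv \<Omega> b w w'" and b: "b \<in> Basis" and u: "u \<in> H10 \<Omega>"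
  shows "L2_inner \<Omega> w' u = - L2_inner \<Omega> w (weak_pderiv \<Omega> b u)"
proof -
  have u1: "u \<in> sobolev (Suc 0) \<Omega>" using u by (simp add: H10_def)
  obtain \<psi> where \<psi>: "\<And>n. test_function \<Omega> (\<psi> n)"
    and lim: "(\<lambda>n. L2_norm \<Omega> (\<lambda>x. u x - \<psi> n x)) \<longlonglongrightarrow> 0"
    and limd: "\<And>b. b \<in> Basis \<Longrightarrow> (\<lambda>n. L2_norm \<Omega> (\<lambda>x. weak_pderiv \<Omega> b u x - pderiv_dir b (\<psi> n) x)) \<longlonglongrightarrow> 0"
    using H10_approx[OF u] by blast
  have "(\<lambda>n. L2_inner \<Omega> w' (\<psi> n)) \<longlonglongrightarrow> L2_inner \<Omega> w' u"
    by (rule L2_inner_tendsto(2)[OF sobolev_imp_L2[OF u1] test_L2[OF \<psi>] w(2) lim])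
  moreover have "(\<lambda>n. - L2_inner \<Omega> w (pderiv_dir b (\<psi> n))) \<longlonglongrightarrow> - L2_inner \<Omega> w (weak_pderiv \<Omega> b u)"
    by (intro tendsto_minus L2_inner_tendsto(2)[OF _ test_L2[OF test_function_pderiv_dir[OF \<psi> b]] w(1) limd[OF b]]
        sobolev_Suc_weak_pderiv[OF u1 b])
  moreover have "L2_inner \<Omega> w' (\<psi> n) = - L2_inner \<Omega> w (pderiv_dir b (\<psi> n))" for n
  proof -
    \<comment> \<open>The inner product conjugates its second argument, so the definition is tested
      with the conjugate of the approximating function.\<close>
    have "(LINT x|lebesgue_on \<Omega>. w x * pderiv_dir b (\<lambda>x. cnj (\<psi> n x)) x) = - (LINT x|lebesgue_on \<Omega>. w' x * cnj (\<psi> n x))"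
      using w(3) test_function_linear[OF \<psi> bounded_linear_cnj, of n] unfolding has_weak_pderiv_def by blast
    then show ?thesis
      unfolding L2_inner_def pderiv_dir_linear[OF bounded_linear_cnj test_function_Ck[OF \<psi>]] by simp
  qed
  ultimately show ?thesis by (simp add: LIMSEQ_unique)
qed

text \<open>The boundary condition is demanded of the second argument alone, so the roles of f and u
  can be exchanged when both satisfy it.\<close>

lemma green:
  assumes "f \<in> sobolev 2 \<Omega>" "u \<in> H10 \<Omega>"
  shows "L2_inner \<Omega> (laplacian \<Omega> f) u = - (\<Sum>b\<in>Basis. L2_inner \<Omega> (weak_pderiv \<Omega> b f) (weak_pderiv \<Omega> b u))"
proof -
  have f1: "f \<in> sobolev (Suc 1) \<Omega>" using assms(1) by (simp only: Suc_1)
  have u: "u \<in> L2 \<Omega>" using assms(2) by (simp add: H10_def)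
  have "L2_inner \<Omega> (laplacian \<Omega> f) u = (\<Sum>b\<in>Basis. L2_inner \<Omega> (weak_pderiv \<Omega> b (weak_pderiv \<Omega> b f)) u)"
    unfolding laplacian_def by (intro L2_inner_sum_left sobolev_2_weak_pderiv assms u)
  also have "\<dots> = (\<Sum>b\<in>Basis. - L2_inner \<Omega> (weak_pderiv \<Omega> b f) (weak_pderiv \<Omega> b u))"
    by (intro sum.cong refl weak_pderiv_by_parts sobolev_2_weak_pderiv sobolev_Suc_weak_pderiv[OF f1] assms)
  finally show ?thesis by (simp add: sum_negf)
qed

text \<open>Green's formula, used once in each direction, moves the Laplacian onto the
  eigenfunction; the eigenvalue is real, so the two conjugations leave it unchanged.\<close>

lemma laplacian_coefficient:
  assumes f: "f \<in> sobolev 2 \<Omega>" "f \<in> H10 \<Omega>" and n: "n \<ge> 1"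
  shows "L2_inner \<Omega> (laplacian \<Omega> f) (\<phi> n) = - of_real (ev n) * L2_inner \<Omega> f (\<phi> n)"
proof -
  note L = \<phi>_L2[OF n] sobolev_imp_L2[OF f(1)] laplacian_L2[OF f(1)] laplacian_L2[OF \<phi>_H2[OF n]]
  have "L2_inner \<Omega> (laplacian \<Omega> f) (\<phi> n) = - (\<Sum>b\<in>Basis. L2_inner \<Omega> (weak_pderiv \<Omega> b f) (weak_pderiv \<Omega> b (\<phi> n)))"
    by (rule green[OF f(1) \<phi>_H10[OF n]])
  also have "\<dots> = cnj (- (\<Sum>b\<in>Basis. L2_inner \<Omega> (weak_pderiv \<Omega> b (\<phi> n)) (weak_pderiv \<Omega> b f)))"
    by (simp flip: L2_inner_commute)
  also have "\<dots> = cnj (L2_inner \<Omega> (laplacian \<Omega> (\<phi> n)) f)"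
    by (simp only: green[OF \<phi>_H2[OF n] f(2)])
  also have "L2_inner \<Omega> (laplacian \<Omega> (\<phi> n)) f = L2_inner \<Omega> (\<lambda>x. - of_real (ev n) * \<phi> n x) f"
  proof (intro L2_inner_cong_AE L L2_cmult)
    show "AE x in lebesgue_on \<Omega>. laplacian \<Omega> (\<phi> n) x = - of_real (ev n) * \<phi> n x"
      using laplacian_\<phi>[OF n]
    proof eventually_elim
      case (elim x)
      from arg_cong[OF this, of uminus] show ?case by simp
    qed
  qed
  also have "cnj \<dots> = - of_real (ev n) * L2_inner \<Omega> f (\<phi> n)"
    unfolding L2_inner_cmult_left by (simp flip: L2_inner_commute)
  finally show ?thesis .
qed

end

subsection \<open>Unboundedness of the eigenvalues\<close>

lemma L2_norm_const_zero: "L2_norm \<Omega> (\<lambda>x. 0) = 0"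
  by (simp add: L2_norm_def)

lemma has_weak_pderiv_zero: "has_weak_pderiv \<Omega> b (\<lambda>x. 0) (\<lambda>x. 0)"
  by (simp add: has_weak_pderiv_def)

context bounded_domain_eigensystem
begin

lemma L2_norm_weak_pderiv_eq:
  assumes "v \<in> L2 \<Omega>" "has_weak_pderiv \<Omega> b u v"
  shows "L2_norm \<Omega> (weak_pderiv \<Omega> b u) = L2_norm \<Omega> v"
  by (intro L2_norm_eq_if_null weak_pderiv_unique[OF _ _ weak_pderiv_spec(2)[OF assms] assms(2)]
      weak_pderiv_spec[OF assms] assms)

lemma test_function_sobolev: "test_function \<Omega> \<psi> \<Longrightarrow> \<psi> \<in> sobolev k \<Omega>"
proof (induction k arbitrary: \<psi>)
  case 0
  then show ?case by (simp add: test_L2)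
next
  case (Suc k)
  have "pderiv_dir b \<psi> \<in> sobolev k \<Omega>" "has_weak_pderiv \<Omega> b \<psi> (pderiv_dir b \<psi>)" if "b \<in> Basis" for b
    using that Suc.prems
    by (simp_all add: Suc.IH test_function_pderiv_dir test_function_has_weak_pderiv open_domain bounded_domain)
  then show ?case using test_L2[OF Suc.prems] by auto
qed

lemma test_function_H10:
  assumes "test_function \<Omega> \<psi>"
  shows "\<psi> \<in> H10 \<Omega>"
proof -
  \<comment> \<open>The derivative chosen for the zero function need not be zero everywhere;
    uniqueness only shows that its norm vanishes.\<close>
  have "sobolev_norm 1 \<Omega> (\<lambda>x. \<psi> x - \<psi> x) = 0"
    by (simp add: L2_norm_const_zero L2_norm_weak_pderiv_eq[OF L2_zero has_weak_pderiv_zero])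
  then have "(\<lambda>n::nat. sobolev_norm 1 \<Omega> (\<lambda>x. \<psi> x - \<psi> x)) \<longlonglongrightarrow> 0" by simp
  then show ?thesis
    unfolding H10_def using assms test_function_sobolev[OF assms]
    by (intro CollectI conjI exI[of _ "\<lambda>n. \<psi>"] allI)
qed

text \<open>Comparing coefficients in Parseval's identity bounds the norm of the Laplacian of \<psi>
  by \<Lambda> times the norm of \<psi>. Green's formula with both arguments equal to \<psi> then
  identifies the sum of the squared norms of the partial derivatives with the modulus of the pairing
  of the Laplacian with \<psi>.\<close>

lemma test_function_gradient_le:
  assumes \<psi>: "test_function \<Omega> \<psi>" and \<Lambda>: "\<And>n. n \<ge> 1 \<Longrightarrow> ev n \<le> \<Lambda>" and b: "b \<in> Basis"
  shows "(L2_norm \<Omega> (pderiv_dir b \<psi>))\<^sup>2 \<le> \<Lambda> * (L2_norm \<Omega> \<psi>)\<^sup>2"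
proof -
  have H: "\<psi> \<in> sobolev 2 \<Omega>" "\<psi> \<in> H10 \<Omega>"
    using \<psi> by (simp_all only: test_function_sobolev test_function_H10)
  let ?L = "laplacian \<Omega> \<psi>"
  have \<Lambda>0: "\<Lambda> \<ge> 0" using \<Lambda>[of 1] ev_pos[of 1] by simp
  note LL = laplacian_L2[OF H(1)]
  have "(L2_norm \<Omega> ?L)\<^sup>2 \<le> \<Lambda>\<^sup>2 * (L2_norm \<Omega> \<psi>)\<^sup>2"
  proof (rule LIMSEQ_le[OF parseval[OF eigensystem LL] tendsto_mult_left[OF parseval[OF eigensystem test_L2[OF \<psi>]]]])
    have "(\<Sum>n=1..N. (cmod (L2_inner \<Omega> ?L (\<phi> n)))\<^sup>2) \<le> \<Lambda>\<^sup>2 * (\<Sum>n=1..N. (cmod (L2_inner \<Omega> \<psi> (\<phi> n)))\<^sup>2)" for N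
      unfolding sum_distrib_left
    proof (rule sum_mono)
      fix n assume "n \<in> {1..N}"
      then have n: "n \<ge> 1" by simp
      have "(ev n)\<^sup>2 \<le> \<Lambda>\<^sup>2" using ev_pos[OF n] \<Lambda>[OF n] by (intro power_mono) auto
      then show "(cmod (L2_inner \<Omega> ?L (\<phi> n)))\<^sup>2 \<le> \<Lambda>\<^sup>2 * (cmod (L2_inner \<Omega> \<psi> (\<phi> n)))\<^sup>2"
        unfolding laplacian_coefficient[OF H n] by (simp add: norm_mult power_mult_distrib mult_right_mono)
    qed
    then show "\<exists>N. \<forall>n\<ge>N. (\<Sum>n=1..n. (cmod (L2_inner \<Omega> ?L (\<phi> n)))\<^sup>2) \<le> \<Lambda>\<^sup>2 * (\<Sum>n=1..n. (cmod (L2_inner \<Omega> \<psi> (\<phi> n)))\<^sup>2)"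
      by blast
  qed
  then have "(L2_norm \<Omega> ?L)\<^sup>2 \<le> (\<Lambda> * L2_norm \<Omega> \<psi>)\<^sup>2"
    by (simp add: power_mult_distrib)
  then have L: "L2_norm \<Omega> ?L \<le> \<Lambda> * L2_norm \<Omega> \<psi>"
    by (rule power2_le_imp_le) (simp add: \<Lambda>0)
  have "(L2_norm \<Omega> (pderiv_dir b \<psi>))\<^sup>2 = (L2_norm \<Omega> (weak_pderiv \<Omega> b \<psi>))\<^sup>2"
    using L2_norm_weak_pderiv_eq[OF test_L2[OF test_function_pderiv_dir[OF \<psi> b]]
        test_function_has_weak_pderiv[OF open_domain bounded_domain b \<psi>]] by simp
  also have "\<dots> \<le> (\<Sum>b\<in>Basis. (L2_norm \<Omega> (weak_pderiv \<Omega> b \<psi>))\<^sup>2)"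
    using b by (intro member_le_sum) auto
  also have "\<dots> = cmod (- (\<Sum>b\<in>Basis. L2_inner \<Omega> (weak_pderiv \<Omega> b \<psi>) (weak_pderiv \<Omega> b \<psi>)))"
    unfolding L2_inner_self of_real_sum[symmetric] norm_minus_cancel norm_of_real by (simp add: sum_nonneg)
  also have "\<dots> = cmod (L2_inner \<Omega> ?L \<psi>)" by (simp only: green[OF H])
  also have "\<dots> \<le> L2_norm \<Omega> ?L * L2_norm \<Omega> \<psi>" by (intro L2_Cauchy_Schwarz LL test_L2 \<psi>)
  also have "\<dots> \<le> \<Lambda> * L2_norm \<Omega> \<psi> * L2_norm \<Omega> \<psi>" by (intro mult_right_mono L) simp
  finally show ?thesis by (simp add: power2_eq_square mult.assoc)
qed

text \<open>Were all test functions null, the first eigenfunction would be orthogonal to all of them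
  and hence null, although its norm is one.\<close>

lemma exists_test_function_pos_norm: "\<exists>\<psi>. test_function \<Omega> \<psi> \<and> L2_norm \<Omega> \<psi> > 0"
proof (rule ccontr)
  assume "\<not> ?thesis"
  then have z: "L2_norm \<Omega> \<psi> = 0" if "test_function \<Omega> \<psi>" for \<psi>
    using that L2_norm_nonneg[of \<Omega> \<psi>] by (auto simp: not_less order_antisym)
  have "L2_norm \<Omega> (\<phi> 1) = 0"
  proof (rule L2_null_if_orthogonal_test)
    show "\<phi> 1 \<in> L2 \<Omega>" by (rule \<phi>_L2) simp
    fix \<psi> :: "'a \<Rightarrow> complex" assume \<psi>: "test_function \<Omega> \<psi>"
    have "cmod (L2_inner \<Omega> (\<phi> 1) (\<lambda>x. cnj (\<psi> x))) \<le> L2_norm \<Omega> (\<phi> 1) * L2_norm \<Omega> (\<lambda>x. cnj (\<psi> x))"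
      by (intro L2_Cauchy_Schwarz \<phi>_L2 L2_cnj test_L2 \<psi>) simp
    also have "L2_norm \<Omega> (\<lambda>x. cnj (\<psi> x)) = 0" by (intro z test_function_linear[OF \<psi>] bounded_linear_cnj)
    finally show "(LINT x|lebesgue_on \<Omega>. \<phi> 1 x * \<psi> x) = 0" by (simp add: L2_inner_def)
  qed
  moreover have "L2_inner \<Omega> (\<phi> 1) (\<phi> 1) = 1"
    using eigensystem by (auto simp: dirichlet_eigensystem_def)
  ultimately show False by (simp add: L2_inner_self)
qed

text \<open>If the eigenvalues were bounded, the Dirichlet energy of test functions would be bounded by
  their norm; multiplication with plane waves of high frequency shows that it is not.\<close>

lemma ev_unbounded: "\<exists>n\<ge>1. ev n > \<Lambda>"
proof (rule ccontr)
  assume "\<not> ?thesis"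
  then have \<Lambda>: "ev n \<le> \<Lambda>" if "n \<ge> 1" for n using that by fastforce
  obtain \<psi> where \<psi>: "test_function \<Omega> \<psi>" and pos: "L2_norm \<Omega> \<psi> > 0"
    using exists_test_function_pos_norm by blast
  obtain b :: 'a where b: "b \<in> Basis" using nonempty_Basis by blast
  have \<Lambda>0: "\<Lambda> > 0" using \<Lambda>[of 1] ev_pos[of 1] by simp
  \<comment> \<open>The square of \<kappa> has to exceed \<open>4 * \<Lambda>\<close>: the estimate
    below has two terms, each contributing \<open>2 * \<Lambda>\<close>.\<close>
  define \<kappa> where "\<kappa> = sqrt (4 * \<Lambda> + 1)"
  let ?e = "plane_wave \<kappa> b"
  have ne: "cmod (?e x) = 1" for x by (simp add: norm_exp_eq_Re)
  let ?g = "\<lambda>x. \<psi> x * ?e x"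
  let ?d = "pderiv_dir b \<psi>"
  have g: "test_function \<Omega> ?g" by (intro test_function_mult \<psi> Ck_plane_wave)
  have de: "test_function \<Omega> (\<lambda>x. ?d x * ?e x)"
    by (intro test_function_mult test_function_pderiv_dir \<psi> b Ck_plane_wave)
  have ng: "L2_norm \<Omega> ?g = L2_norm \<Omega> \<psi>" "L2_norm \<Omega> (\<lambda>x. - 1 * (?d x * ?e x)) = L2_norm \<Omega> ?d"
    by (simp_all add: L2_norm_def norm_mult ne)
  have "pderiv_dir b ?g = (\<lambda>x. \<psi> x * (\<i> * of_real \<kappa> * ?e x) + ?d x * ?e x)"
    using pderiv_dir_mult[OF test_function_Ck[OF \<psi>] Ck_plane_wave, where b=b] b
    unfolding pderiv_dir_plane_wave by simp
  \<comment> \<open>The product rule solved for the term that carries the frequency; the other two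
    terms are derivatives of test functions up to a factor of modulus one.\<close>
  then have eq: "(\<lambda>x. \<i> * of_real \<kappa> * ?g x) = (\<lambda>x. pderiv_dir b ?g x + - 1 * (?d x * ?e x))"
    by (simp add: fun_eq_iff)
  have "\<kappa>\<^sup>2 * (L2_norm \<Omega> \<psi>)\<^sup>2 = (L2_norm \<Omega> (\<lambda>x. \<i> * of_real \<kappa> * ?g x))\<^sup>2"
    unfolding L2_norm_cmult ng by (simp add: norm_mult power_mult_distrib)
  also have "\<dots> \<le> 2 * (L2_norm \<Omega> (pderiv_dir b ?g))\<^sup>2 + 2 * (L2_norm \<Omega> (\<lambda>x. - 1 * (?d x * ?e x)))\<^sup>2"
    unfolding eq by (intro L2_norm_add_square_le L2_cmult test_L2 test_function_pderiv_dir g b de)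
  also have "\<dots> \<le> 2 * (\<Lambda> * (L2_norm \<Omega> \<psi>)\<^sup>2) + 2 * (\<Lambda> * (L2_norm \<Omega> \<psi>)\<^sup>2)"
    using test_function_gradient_le[OF g \<Lambda> b] test_function_gradient_le[OF \<psi> \<Lambda> b]
    unfolding ng by simp
  also have "\<dots> = 4 * \<Lambda> * (L2_norm \<Omega> \<psi>)\<^sup>2" by simp
  finally have "\<kappa>\<^sup>2 \<le> 4 * \<Lambda>" using pos by simp
  then show False using \<Lambda>0 by (simp add: \<kappa>_def)
qed

lemma ev_at_top: "filterlim (\<lambda>n. ev (Suc n)) at_top sequentially"
proof -
  have inc: "incseq (\<lambda>n. ev (Suc n))" by (intro incseq_SucI ev_le_Suc) simp
  have "\<exists>N. \<forall>n\<ge>N. Z \<le> ev (Suc n)" for Z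
  proof -
    obtain n where "n \<ge> 1" "ev n > Z" using ev_unbounded by blast
    then have "Z \<le> ev (Suc (n - 1))" by simp
    then show ?thesis using inc unfolding incseq_def by (meson order_trans)
  qed
  then show ?thesis by (simp add: filterlim_at_top eventually_sequentially)
qed

end

subsection \<open>Smooth steps on the real line\<close>

lemma pderiv_dir_real: "(f has_real_derivative D) (at x) \<Longrightarrow> pderiv_dir 1 f x = D"
  using pderiv_dir_eq[of f "(*) D" x 1] by (simp add: has_field_derivative_def)

lemma Ck_real_SucI:
  fixes f :: "real \<Rightarrow> real"
  assumes "\<And>x. (f has_real_derivative f' x) (at x)" "Ck k f'"
  shows "Ck (Suc k) f"
proof -
  have "pderiv_dir 1 f = f'" using pderiv_dir_real[OF assms(1)] by (intro ext)
  moreover have "f differentiable (at x)" for x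
    using assms(1) by (auto simp: real_differentiable_def)
  ultimately show ?thesis using assms(2) by simp
qed

lemma Ck_real_has_derivative:
  fixes f :: "real \<Rightarrow> real"
  assumes "Ck (Suc k) f"
  shows "(f has_real_derivative pderiv_dir 1 f x) (at x)"
proof -
  obtain D where D: "(f has_real_derivative D) (at x)"
    using Ck_differentiable[OF assms, of x] by (auto simp: real_differentiable_def)
  then show ?thesis using pderiv_dir_real[OF D] by simp
qed

lemma Ck_compose_affine:
  fixes f :: "real \<Rightarrow> real"
  shows "Ck k f \<Longrightarrow> Ck k (\<lambda>x. f (\<alpha> * x + \<beta>))"
proof (induction k arbitrary: f)
  case 0
  then show ?case
    by (auto intro!: continuous_on_compose2[of UNIV f] continuous_intros)
next
  case (Suc k)
  show ?case
  proof (rule Ck_real_SucI)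
    show "((\<lambda>x. f (\<alpha> * x + \<beta>)) has_real_derivative \<alpha> * pderiv_dir 1 f (\<alpha> * x + \<beta>)) (at x)" for x
    proof -
      have "((\<lambda>x. \<alpha> * x + \<beta>) has_real_derivative \<alpha>) (at x)"
        by (auto intro!: derivative_eq_intros)
      from DERIV_chain2[OF Ck_real_has_derivative[OF Suc.prems] this]
      show ?thesis by (simp add: mult.commute)
    qed
    have "Ck k (\<lambda>x. pderiv_dir 1 f (\<alpha> * x + \<beta>))" using Suc by simp
    then show "Ck k (\<lambda>x. \<alpha> * pderiv_dir 1 f (\<alpha> * x + \<beta>))"
      by (rule Ck_linear[OF bounded_linear_mult_right])
  qed
qed

text \<open>A polynomial in y = 1/x times exp(-y), extended by zero. The family is closed under
  differentiation, which sends p to \<open>y\<^sup>2 * (p - p')\<close>, so smoothness follows by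
  induction over all p at once.\<close>

definition flat :: "real poly \<Rightarrow> real \<Rightarrow> real" where
  "flat p x = (if x > 0 then poly p (1 / x) * exp (- (1 / x)) else 0)"

lemma poly_div_exp_tendsto_0: "((\<lambda>y. poly p y / exp y) \<longlongrightarrow> (0::real)) at_top"
proof -
  have "((\<lambda>y. \<Sum>i\<le>degree p. coeff p i * (y ^ i / exp y)) \<longlongrightarrow> (\<Sum>i\<le>degree p. coeff p i * 0)) at_top"
    by (intro tendsto_intros tendsto_power_div_exp_0)
  then show ?thesis by (simp add: poly_altdef sum_divide_distrib)
qed

lemma flat_tendsto_0: "(flat p \<longlongrightarrow> 0) (at_right 0)"
proof -
  have "((\<lambda>x. poly p (inverse x) / exp (inverse x)) \<longlongrightarrow> 0) (at_right (0::real))"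
    by (rule filterlim_compose[OF poly_div_exp_tendsto_0 filterlim_inverse_at_top_right])
  moreover have "eventually (\<lambda>x. poly p (inverse x) / exp (inverse x) = flat p x) (at_right (0::real))"
    using eventually_at_right_less[of "0::real"]
    by eventually_elim (simp add: flat_def exp_minus divide_inverse)
  ultimately show ?thesis by (rule Lim_transform_eventually)
qed

lemma flat_has_derivative: "(flat p has_real_derivative flat ([:0, 0, 1:] * (p - pderiv p)) x) (at x)"
proof -
  consider "x > 0" | "x < 0" | "x = 0" by linarith
  then show ?thesis
  proof cases
    case 1
    have "((\<lambda>x. poly p (1 / x) * exp (- (1 / x))) has_real_derivative
        flat ([:0, 0, 1:] * (p - pderiv p)) x) (at x)"
      using 1 by (auto intro!: derivative_eq_intros poly_DERIV[THEN DERIV_chain2]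
          simp: flat_def field_simps power2_eq_square)
    then show ?thesis
      by (rule has_field_derivative_transform_within_open[of _ _ _ "{0<..}"]) (use 1 in \<open>auto simp: flat_def\<close>)
  next
    case 2
    have "((\<lambda>x. 0) has_real_derivative flat ([:0, 0, 1:] * (p - pderiv p)) x) (at x)"
      using 2 by (simp add: flat_def)
    then show ?thesis
      by (rule has_field_derivative_transform_within_open[of _ _ _ "{..<0}"]) (use 2 in \<open>auto simp: flat_def\<close>)
  next
    case 3
    have "((\<lambda>h. (flat p (0 + h) - flat p 0) / h) \<longlongrightarrow> 0) (at 0)"
    proof (rule filterlim_split_at)
      have "eventually (\<lambda>h. 0 = (flat p (0 + h) - flat p 0) / h) (at_left 0)"
        by (simp add: eventually_at_filter flat_def)
      then show "((\<lambda>h. (flat p (0 + h) - flat p 0) / h) \<longlongrightarrow> 0) (at_left 0)"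
        by (rule Lim_transform_eventually[OF tendsto_const])
      \<comment> \<open>Dividing by h multiplies the polynomial by its variable 1/h, so the
        difference quotient at the origin is again a member of the family.\<close>
      have "eventually (\<lambda>h. flat (pCons 0 p) h = (flat p (0 + h) - flat p 0) / h) (at_right 0)"
        using eventually_at_right_less[of "0::real"] by eventually_elim (simp add: flat_def)
      then show "((\<lambda>h. (flat p (0 + h) - flat p 0) / h) \<longlongrightarrow> 0) (at_right 0)"
        by (rule Lim_transform_eventually[OF flat_tendsto_0])
    qed
    then show ?thesis using 3 by (simp add: DERIV_def flat_def)
  qed
qed

lemma Ck_flat: "Ck k (flat p)"
proof (induction k arbitrary: p)
  case 0
  show ?case
    using DERIV_isCont[OF flat_has_derivative] by (simp add: continuous_at_imp_continuous_on)
next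
  case (Suc k)
  show ?case by (rule Ck_real_SucI[OF flat_has_derivative Suc.IH])
qed

text \<open>The function exp(-1/x) times its mirror image about 1/2: smooth, and positive exactly
  between 0 and 1.\<close>

definition bump :: "real \<Rightarrow> real" where
  "bump x = flat 1 x * flat 1 (1 - x)"

lemma Ck_bump: "Ck k bump"
proof -
  have "Ck k (\<lambda>x. flat 1 ((-1) * x + 1))" by (rule Ck_compose_affine[OF Ck_flat])
  then have "Ck k (\<lambda>x. flat 1 x * flat 1 ((-1) * x + 1))" by (rule Ck_mult[OF Ck_flat])
  then show ?thesis by (simp add: bump_def[abs_def])
qed

lemma bump_nonneg: "bump x \<ge> 0"
  and bump_outside: "x \<le> 0 \<or> x \<ge> 1 \<Longrightarrow> bump x = 0"
  and bump_pos: "0 < x \<Longrightarrow> x < 1 \<Longrightarrow> bump x > 0"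
  by (auto simp: bump_def flat_def)

lemma continuous_on_bump: "continuous_on S bump"
  using Ck_imp_continuous[OF Ck_bump] continuous_on_subset by blast

text \<open>The primitive of \<open>bump\<close>, divided by its final value. The derivative \<rho>
  is kept in the statement because, rescaled, it serves as an approximate point mass.\<close>

lemma smooth_step_exists:
  "\<exists>P \<rho> :: real \<Rightarrow> real. (\<forall>k. Ck k P) \<and> (\<forall>x. (P has_real_derivative \<rho> x) (at x)) \<and>
     continuous_on UNIV \<rho> \<and> (\<forall>x. \<rho> x \<ge> 0) \<and> (\<forall>x. x \<le> 0 \<or> x \<ge> 1 \<longrightarrow> \<rho> x = 0) \<and>
     (\<forall>x\<le>0. P x = 0) \<and> (\<forall>x\<ge>1. P x = 1)"
proof -
  \<comment> \<open>Starting at -1, to the left of the support, makes 0 an interior point of the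
    range in which the primitive is differentiated; up to -1 it is zero anyway.\<close>
  define Q where "Q x = integral {-1..x} bump" for x
  have int: "bump integrable_on {x..y}" for x y
    by (intro integrable_continuous_interval continuous_on_bump)
  have DQ: "(Q has_real_derivative bump x) (at x)" for x
  proof (cases "x > -1")
    case True
    have "(Q has_real_derivative bump x) (at x within {-1..x + 1})"
      unfolding Q_def[abs_def] using True by (intro integral_has_real_derivative continuous_on_bump) auto
    then show ?thesis
      using True at_within_interior[of x "{-1..x + 1}"] by simp
  next
    case False
    have "((\<lambda>x. 0) has_real_derivative bump x) (at x)"
      using False by (simp add: bump_outside)
    then show ?thesis
    proof (rule has_field_derivative_transform_within_open[of _ _ _ "{..<0}"])
      fix y :: real assume "y \<in> {..<0}"
      then have "integral {-1..y} bump = integral {-1..y} (\<lambda>x. 0)"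
        by (intro integral_cong) (simp add: bump_outside)
      then show "0 = Q y" by (simp add: Q_def)
    qed (use False in auto)
  qed
  have Q0: "Q x = 0" if "x \<le> 0" for x
  proof -
    have "integral {-1..x} bump = integral {-1..x} (\<lambda>x. 0)"
      using that by (intro integral_cong) (simp add: bump_outside)
    then show ?thesis by (simp add: Q_def)
  qed
  have Q1: "Q x = Q 1" if "x \<ge> 1" for x
  proof -
    have "integral {1..x} bump = integral {1..x} (\<lambda>x. 0)"
      by (intro integral_cong) (simp add: bump_outside)
    moreover have "integral {-1..1} bump + integral {1..x} bump = integral {-1..x} bump"
      using that by (intro Henstock_Kurzweil_Integration.integral_combine int) auto
    ultimately show ?thesis by (simp add: Q_def)
  qed
  have "Q 1 > Q 0"
  proof (rule DERIV_pos_imp_increasing_open[of 0 1 Q])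
    show "\<And>x. 0 < x \<Longrightarrow> x < 1 \<Longrightarrow> \<exists>y. (Q has_real_derivative y) (at x) \<and> y > 0"
      using DQ bump_pos by blast
    show "continuous_on {0..1} Q"
      using DQ by (intro continuous_at_imp_continuous_on ballI DERIV_isCont)
  qed simp
  then have pos: "Q 1 > 0" using Q0[of 0] by simp
  have D: "((\<lambda>x. Q x / Q 1) has_real_derivative bump x / Q 1) (at x)" for x
    by (intro DERIV_cdivide DQ)
  have "Ck (Suc k) (\<lambda>x. Q x / Q 1)" for k
    by (rule Ck_real_SucI[OF D Ck_linear[OF bounded_linear_divide Ck_bump]])
  then have C: "Ck k (\<lambda>x. Q x / Q 1)" for k by (rule Ck_Suc_imp)
  have c: "continuous_on UNIV (\<lambda>x. bump x / Q 1)"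
    using pos by (intro continuous_intros continuous_on_bump) auto
  have one: "Q x / Q 1 = 1" if "x \<ge> 1" for x using Q1[OF that] pos by simp
  show ?thesis
    by (rule exI[of _ "\<lambda>x. Q x / Q 1"], rule exI[of _ "\<lambda>x. bump x / Q 1"])
       (intro conjI allI impI; (rule D C c | erule one | use pos in \<open>auto simp: Q0 bump_nonneg bump_outside\<close>))
qed

lemma test_function_intervalI:
  fixes \<eta> :: "real \<Rightarrow> real"
  assumes "\<And>k. Ck k \<eta>" "\<And>t. t < c \<or> t > d \<Longrightarrow> \<eta> t = 0" "{c..d} \<subseteq> \<Omega>"
  shows "test_function \<Omega> \<eta>"
proof -
  have "closure {t. \<eta> t \<noteq> 0} \<subseteq> {c..d}"
    by (rule closure_minimal) (use assms(2) in \<open>force simp: not_less\<close>, simp)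
  moreover from this have "compact (closure {t. \<eta> t \<noteq> 0})"
    using compact_Int_closed[of "{c..d}" "closure {t. \<eta> t \<noteq> 0}"] by (auto simp: Int_absorb1)
  ultimately show ?thesis using assms by (auto simp: test_function_def)
qed

lemma lebesgue_on_open_interval_eq_integral:
  fixes g :: "real \<Rightarrow> 'b::euclidean_space"
  assumes "continuous_on {a..b} g"
  shows "integrable (lebesgue_on {a<..<b}) g" "(LINT t|lebesgue_on {a<..<b}. g t) = integral {a..b} g"
proof -
  have "integrable (lebesgue_on {a..b}) g"
    using continuous_imp_integrable_real[OF assms] .
  then have "set_integrable lebesgue {a..b} g"
    by (simp add: integrable_restrict_space set_integrable_def)
  then have "set_integrable lebesgue {a<..<b} g"
    by (rule set_integrable_subset) auto
  then show 1: "integrable (lebesgue_on {a<..<b}) g"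
    by (simp add: integrable_restrict_space set_integrable_def)
  have "(LINT t|lebesgue_on {a<..<b}. g t) = integral {a<..<b} g"
    by (rule lebesgue_integral_eq_integral[OF 1]) simp
  then show "(LINT t|lebesgue_on {a<..<b}. g t) = integral {a..b} g"
    by (simp add: integral_open_interval_real)
qed

subsection \<open>Weak derivatives in time\<close>

text \<open>An average with respect to a probability density k differs from z by at most \<epsilon>
  if w does so wherever k is nonzero.\<close>

lemma integral_kernel_approx:
  fixes w :: "real \<Rightarrow> complex"
  assumes "continuous_on {0..T} w" "continuous_on {0..T} k" "\<And>t. k t \<ge> 0" "(k has_integral 1) {0..T}"
    and "\<And>t. t \<in> {0..T} \<Longrightarrow> k t \<noteq> 0 \<Longrightarrow> norm (w t - z) \<le> \<epsilon>"
  shows "norm (integral {0..T} (\<lambda>t. of_real (k t) * w t) - z) \<le> \<epsilon>"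
proof -
  have k1: "((\<lambda>t. of_real (k t) * z) has_integral z) {0..T}"
    using has_integral_mult_left[OF has_integral_of_real[OF assms(4)], of z] by simp
  have i: "(\<lambda>t. of_real (k t) * w t) integrable_on {0..T}"
    by (intro integrable_continuous_interval continuous_intros assms)
  have "integral {0..T} (\<lambda>t. of_real (k t) * w t) - z = integral {0..T} (\<lambda>t. of_real (k t) * (w t - z))"
    using integral_diff[OF i has_integral_integrable[OF k1]] integral_unique[OF k1]
    by (simp add: right_diff_distrib)
  also have "norm \<dots> \<le> integral {0..T} (\<lambda>t. \<epsilon> * k t)"
  proof (rule integral_norm_bound_integral)
    show "(\<lambda>t. of_real (k t) * (w t - z)) integrable_on {0..T}"
      by (intro integrable_continuous_interval continuous_intros assms)
    show "(\<lambda>t. \<epsilon> * k t) integrable_on {0..T}"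
      by (intro integrable_continuous_interval continuous_intros assms)
    show "norm (of_real (k t) * (w t - z)) \<le> \<epsilon> * k t" if "t \<in> {0..T}" for t
      using assms(3)[of t] assms(5)[OF that]
      by (cases "k t = 0") (auto simp: norm_mult mult.commute intro: mult_right_mono)
  qed
  also have "\<dots> = \<epsilon>" using integral_unique[OF assms(4)] by simp
  finally show ?thesis .
qed

text \<open>The lemma of du Bois-Reymond: the test function is the difference of two smooth steps,
  whose derivative is a difference of approximate point masses.\<close>

lemma weak_derivative_zero_imp_constant:
  fixes w :: "real \<Rightarrow> complex"
  assumes w: "continuous_on {0..T} w"
    and weak: "\<And>\<eta>. test_function {0<..<T} \<eta> \<Longrightarrow> (LINT t|lebesgue_on {0<..<T}. of_real (deriv \<eta> t) * w t) = 0"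
    and s: "0 < s1" "s1 < s2" "s2 < T"
  shows "w s1 = w s2"
proof -
  obtain \<rho> P :: "real \<Rightarrow> real"
    where "\<forall>k. Ck k P" "\<forall>x. (P has_real_derivative \<rho> x) (at x)" "continuous_on UNIV \<rho>"
      and "\<forall>x. \<rho> x \<ge> 0" "\<forall>x. x \<le> 0 \<or> x \<ge> 1 \<longrightarrow> \<rho> x = 0"
      and "\<forall>x\<le>0. P x = 0" "\<forall>x\<ge>1. P x = 1"
    using smooth_step_exists by blast
  then have P: "\<And>k. Ck k P" "\<And>x. (P has_real_derivative \<rho> x) (at x)" and \<rho>: "continuous_on UNIV \<rho>"
      and \<rho>0: "\<And>x. \<rho> x \<ge> 0" "\<And>x. x \<le> 0 \<or> x \<ge> 1 \<Longrightarrow> \<rho> x = 0"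
      and P0: "\<And>x. x \<le> 0 \<Longrightarrow> P x = 0" and P1: "\<And>x. x \<ge> 1 \<Longrightarrow> P x = 1"
    by auto
  have "dist (w s1) (w s2) \<le> \<epsilon>" if "\<epsilon> > 0" for \<epsilon>
  proof -
    have "uniformly_continuous_on {0..T} w"
      by (rule compact_uniformly_continuous[OF w]) simp
    then obtain d where d: "d > 0" "\<And>x y. x \<in> {0..T} \<Longrightarrow> y \<in> {0..T} \<Longrightarrow> dist y x < d \<Longrightarrow> dist (w y) (w x) < \<epsilon> / 2"
      using \<open>\<epsilon> > 0\<close> unfolding uniformly_continuous_on_def by (metis half_gt_zero)
    \<comment> \<open>The first bound keeps the kernels within the range of uniform continuity, the
      second keeps the support of the later kernel, reaching up to \<open>s2 + \<delta>\<close>,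
      inside the open interval.\<close>
    define \<delta> where "\<delta> = min (d / 2) ((T - s2) / 2)"
    have \<delta>: "\<delta> > 0" "\<delta> < d" "s2 + \<delta> < T" using d s by (auto simp: \<delta>_def min_def field_simps)
    \<comment> \<open>The density \<open>k s\<close> has width \<delta> and sits immediately to the
      right of s; \<open>p s\<close> is its primitive, rising from 0 to 1 there.\<close>
    define k where "k s t = \<rho> ((1 / \<delta>) * t + (- s / \<delta>)) / \<delta>" for s t
    define p where "p s t = P ((1 / \<delta>) * t + (- s / \<delta>))" for s t
    have Dp: "(p s has_real_derivative k s t) (at t)" for s t
    proof -
      have "((\<lambda>t. (1 / \<delta>) * t + (- s / \<delta>)) has_real_derivative 1 / \<delta>) (at t)"
        using \<delta>(1) by (auto intro!: derivative_eq_intros)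
      from DERIV_chain2[OF P(2) this] show ?thesis using \<delta>(1) by (simp add: p_def[abs_def] k_def)
    qed
    have kc: "continuous_on {0..T} (k s)" for s
      unfolding k_def using \<delta>(1)
      by (intro continuous_intros continuous_on_compose2[OF \<rho>]) auto
    have k0: "k s t \<ge> 0" for s t using \<rho>0(1) \<delta>(1) by (simp add: k_def)
    have p0: "p s t = 0" if "t \<le> s" for s t
      unfolding p_def using that \<delta>(1) by (intro P0) (simp add: field_simps)
    have p1: "p s t = 1" if "t \<ge> s + \<delta>" for s t
      unfolding p_def using that \<delta>(1) by (intro P1) (simp add: field_simps)
    have kz: "t \<in> {s..s + \<delta>}" if "k s t \<noteq> 0" for s t
    proof (rule ccontr)
      assume "t \<notin> {s..s + \<delta>}"
      then have "(1 / \<delta>) * t + (- s / \<delta>) \<le> 0 \<or> (1 / \<delta>) * t + (- s / \<delta>) \<ge> 1"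
        using \<delta>(1) by (auto simp: field_simps)
      then have "\<rho> ((1 / \<delta>) * t + (- s / \<delta>)) = 0" by (rule \<rho>0(2))
      then show False using that by (simp add: k_def)
    qed
    have near: "norm (integral {0..T} (\<lambda>t. of_real (k s t) * w t) - w s) \<le> \<epsilon> / 2"
      if s': "0 < s" "s + \<delta> < T" for s
    proof (rule integral_kernel_approx[OF w kc k0])
      have "(k s has_integral (p s T - p s 0)) {0..T}"
        using s' \<delta>(1) Dp by (intro fundamental_theorem_of_calculus)
          (auto intro: DERIV_subset[OF Dp] simp flip: has_real_derivative_iff_has_vector_derivative)
      then show "(k s has_integral 1) {0..T}" using p0[of 0 s] p1[of s T] s' by simp
      show "norm (w t - w s) \<le> \<epsilon> / 2" if "t \<in> {0..T}" "k s t \<noteq> 0" for t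
        using d(2)[of s t] that kz[OF that(2)] s' \<delta> by (auto simp: dist_norm intro!: less_imp_le)
    qed
    \<comment> \<open>Past \<open>s2 + \<delta>\<close> both steps equal 1 and cancel, which gives
      compact support. The derivative is the difference of the two kernels, so its vanishing pairing
      with w equates the averages near the two points.\<close>
    define \<eta> where "\<eta> t = p s1 t + (- 1) * p s2 t" for t
    have "test_function {0<..<T} \<eta>"
    proof (rule test_function_intervalI[of _ s1 "s2 + \<delta>"])
      show "Ck k \<eta>" for k
        unfolding \<eta>_def p_def
        by (intro Ck_add Ck_compose_affine P(1) Ck_linear[OF bounded_linear_mult_right])
      show "\<eta> t = 0" if "t < s1 \<or> t > s2 + \<delta>" for t
        using that p0[of t s1] p0[of t s2] p1[of s1 t] p1[of s2 t] s by (auto simp: \<eta>_def)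
    qed (use s \<delta> in auto)
    note weak[OF this]
    also have "deriv \<eta> = (\<lambda>t. k s1 t - k s2 t)"
    proof
      have "(\<eta> has_real_derivative k s1 t - k s2 t) (at t)" for t
        unfolding \<eta>_def[abs_def] using DERIV_diff[OF Dp Dp] by simp
      then show "deriv \<eta> t = k s1 t - k s2 t" for t by (rule DERIV_imp_deriv)
    qed
    finally have "0 = integral {0..T} (\<lambda>t. of_real (k s1 t - k s2 t) * w t)"
      by (subst (asm) lebesgue_on_open_interval_eq_integral) (auto intro!: continuous_intros w kc)
    also have "\<dots> = integral {0..T} (\<lambda>t. of_real (k s1 t) * w t) - integral {0..T} (\<lambda>t. of_real (k s2 t) * w t)"
      by (subst integral_diff[symmetric])
        (auto intro!: integrable_continuous_interval continuous_intros w kc simp: left_diff_distrib)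
    finally have "integral {0..T} (\<lambda>t. of_real (k s1 t) * w t) = integral {0..T} (\<lambda>t. of_real (k s2 t) * w t)"
      by simp
    then have "norm (integral {0..T} (\<lambda>t. of_real (k s2 t) * w t) - w s1) \<le> \<epsilon> / 2"
      "norm (integral {0..T} (\<lambda>t. of_real (k s2 t) * w t) - w s2) \<le> \<epsilon> / 2"
      using near[of s1] near[of s2] s \<delta> by simp_all
    from norm_triangle_le_diff[OF add_mono[OF this(2,1)]] show ?thesis
      by (simp add: dist_norm)
  qed
  then show ?thesis by (metis dist_le_zero_iff field_le_epsilon add_0)
qed

lemma continuous_constant_closure:
  fixes w :: "real \<Rightarrow> complex"
  assumes "continuous_on {0..T} w" "\<And>t. 0 < t \<Longrightarrow> t < T \<Longrightarrow> w t = c" "T > 0" "t \<in> {0..T}"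
  shows "w t = c"
  using continuous_constant_on_closure[of "{0<..<T}" w c t] assms by (simp add: closure_greaterThanLessThan)

text \<open>Subtracting from u the primitive of h leaves a continuous function with vanishing weak
  derivative, hence a constant. The derivative is one-sided at 0 and T, where the initial condition
  and the measurement live.\<close>

lemma weak_derivative_imp_has_vector_derivative:
  fixes u h :: "real \<Rightarrow> complex"
  assumes T: "T > 0" and u: "continuous_on {0..T} u" and h: "continuous_on {0..T} h"
    and weak: "\<And>\<eta>. test_function {0<..<T} \<eta> \<Longrightarrow>
      (LINT t|lebesgue_on {0<..<T}. of_real (deriv \<eta> t) * u t) = - (LINT t|lebesgue_on {0<..<T}. of_real (\<eta> t) * h t)"
    and t: "t \<in> {0..T}"
  shows "(u has_vector_derivative h t) (at t within {0..T})"
proof -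
  define H where "H t = integral {0..t} h" for t
  have DH: "(H has_vector_derivative h t) (at t within {0..T})" if "t \<in> {0..T}" for t
    unfolding H_def[abs_def] using integral_has_vector_derivative[OF h that] .
  have Hc: "continuous_on {0..T} H"
    using DH by (rule continuous_on_vector_derivative)
  define w where "w t = u t - H t" for t
  have wc: "continuous_on {0..T} w" unfolding w_def by (intro continuous_intros u Hc)
  have weak0: "(LINT t|lebesgue_on {0<..<T}. of_real (deriv \<eta> t) * w t) = 0"
    if \<eta>: "test_function {0<..<T} \<eta>" for \<eta>
  proof -
    have D: "(\<eta> has_real_derivative deriv \<eta> t) (at t)" for t
      using DERIV_deriv_iff_real_differentiable Ck_differentiable[OF test_function_Ck[OF \<eta>]]
      by blast
    have "deriv \<eta> = pderiv_dir 1 \<eta>" using pderiv_dir_real[OF D] by (intro ext) simp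
    then have dc: "continuous_on A (deriv \<eta>)" for A
      using Ck_imp_continuous[OF test_function_Ck[OF test_function_pderiv_dir[OF \<eta>, of 1], of 0]]
      by (auto intro: continuous_on_subset)
    have ec: "continuous_on A \<eta>" for A
      using D by (intro continuous_at_imp_continuous_on ballI DERIV_isCont)
    have z: "\<eta> 0 = 0" "\<eta> T = 0" using test_function_outside[OF \<eta>] by auto
    have "((\<lambda>t. of_real (\<eta> t) * h t + of_real (deriv \<eta> t) * H t) has_integral
        (of_real (\<eta> T) * H T - of_real (\<eta> 0) * H 0)) {0..T}"
    proof (rule fundamental_theorem_of_calculus)
      fix t assume t: "t \<in> {0..T}"
      have "((\<lambda>t. of_real (\<eta> t) :: complex) has_vector_derivative of_real (deriv \<eta> t)) (at t within {0..T})"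
        using D[of t] by (intro has_vector_derivative_of_real)
          (simp add: has_real_derivative_iff_has_vector_derivative has_vector_derivative_at_within)
      from has_vector_derivative_mult[OF this DH[OF t]]
      show "((\<lambda>t. of_real (\<eta> t) * H t) has_vector_derivative of_real (\<eta> t) * h t + of_real (deriv \<eta> t) * H t) (at t within {0..T})" .
    qed (use T in simp)
    then have "integral {0..T} (\<lambda>t. of_real (\<eta> t) * h t + of_real (deriv \<eta> t) * H t) = 0"
      unfolding z by (simp add: integral_unique)
    then have parts: "integral {0..T} (\<lambda>t. of_real (\<eta> t) * h t) + integral {0..T} (\<lambda>t. of_real (deriv \<eta> t) * H t) = 0"
      by (subst (asm) integral_add) (auto intro!: integrable_continuous_interval continuous_intros dc ec Hc h)
    have "(LINT t|lebesgue_on {0<..<T}. of_real (deriv \<eta> t) * w t) = integral {0..T} (\<lambda>t. of_real (deriv \<eta> t) * w t)"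
      by (intro lebesgue_on_open_interval_eq_integral continuous_intros dc wc)
    also have "\<dots> = integral {0..T} (\<lambda>t. of_real (deriv \<eta> t) * u t) - integral {0..T} (\<lambda>t. of_real (deriv \<eta> t) * H t)"
      unfolding w_def right_diff_distrib
      by (intro integral_diff integrable_continuous_interval continuous_intros dc u Hc)
    also have "integral {0..T} (\<lambda>t. of_real (deriv \<eta> t) * u t) = - integral {0..T} (\<lambda>t. of_real (\<eta> t) * h t)"
      using weak[OF \<eta>]
      by (subst (asm) (1 2) lebesgue_on_open_interval_eq_integral(2)) (auto intro!: continuous_intros dc ec u h)
    finally show ?thesis using parts by (simp add: add_eq_0_iff)
  qed
  \<comment> \<open>The midpoint is an interior reference value; continuity carries the equality to
    both endpoints afterwards.\<close>
  have "w t = w (T / 2)" if "0 < t" "t < T" for t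
    using weak_derivative_zero_imp_constant[OF wc weak0, of t "T / 2"]
      weak_derivative_zero_imp_constant[OF wc weak0, of "T / 2" t] that T by (cases t "T / 2" rule: linorder_cases) auto
  then have const: "w t = w (T / 2)" if "t \<in> {0..T}" for t
    using continuous_constant_closure[OF wc _ T that] by blast
  have "((\<lambda>t. w (T / 2) + H t) has_vector_derivative 0 + h t) (at t within {0..T})"
    by (intro has_vector_derivative_add DH t) auto
  moreover have "w (T / 2) + H t = u t" if "t \<in> {0..T}" for t
    using const[OF that] by (simp add: w_def algebra_simps)
  ultimately show ?thesis
    using has_vector_derivative_transform[OF t, of u "\<lambda>t. w (T / 2) + H t"] by simp
qed

text \<open>Duhamel's formula, obtained with the integrating factor exp(\<mu> t) and cleared of the
  denominator \<mu> - \<gamma>.\<close>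

lemma linear_ode_final_value:
  fixes u :: "real \<Rightarrow> complex" and c \<mu> \<gamma> :: complex
  assumes T: "T > 0" and u0: "u 0 = 0" and ne: "\<mu> \<noteq> \<gamma>"
    and D: "\<And>t. t \<in> {0..T} \<Longrightarrow> (u has_vector_derivative exp (- \<gamma> * of_real t) * c - \<mu> * u t) (at t within {0..T})"
  shows "(\<mu> - \<gamma>) * u T = (exp (- \<gamma> * of_real T) - exp (- \<mu> * of_real T)) * c"
proof -
  \<comment> \<open>The subtracted term is a primitive of the source after multiplication by the
    integrating factor, so v is constant; comparing v at 0 and T gives the formula.\<close>
  define v where "v t = exp (\<mu> * of_real t) * u t - exp ((\<mu> - \<gamma>) * of_real t) / (\<mu> - \<gamma>) * c" for t
  have E: "((\<lambda>t. exp (\<alpha> * of_real t)) has_vector_derivative exp (\<alpha> * of_real t) * \<alpha>) (at t within {0..T})"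
    for \<alpha> :: complex and t
  proof -
    have "((\<lambda>z. exp (\<alpha> * z)) has_field_derivative exp (\<alpha> * of_real t) * \<alpha>) (at (of_real t))"
      by (auto intro!: derivative_eq_intros)
    then show ?thesis by (rule has_vector_derivative_real_field)
  qed
  have "(v has_vector_derivative 0) (at t within {0..T})" if t: "t \<in> {0..T}" for t
  proof -
    have "((\<lambda>t. exp (\<mu> * of_real t) * u t - exp ((\<mu> - \<gamma>) * of_real t) * (c / (\<mu> - \<gamma>))) has_vector_derivative
       (exp (\<mu> * of_real t) * (exp (- \<gamma> * of_real t) * c - \<mu> * u t) + exp (\<mu> * of_real t) * \<mu> * u t)
       - exp ((\<mu> - \<gamma>) * of_real t) * (\<mu> - \<gamma>) * (c / (\<mu> - \<gamma>))) (at t within {0..T})"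
      by (intro has_vector_derivative_diff has_vector_derivative_mult has_vector_derivative_mult_left E D t)
    also have "exp ((\<mu> - \<gamma>) * of_real t) * (\<mu> - \<gamma>) * (c / (\<mu> - \<gamma>)) = exp ((\<mu> - \<gamma>) * of_real t) * c"
      using ne by simp
    also have "(exp (\<mu> * of_real t) * (exp (- \<gamma> * of_real t) * c - \<mu> * u t) + exp (\<mu> * of_real t) * \<mu> * u t)
       - exp ((\<mu> - \<gamma>) * of_real t) * c
       = exp (\<mu> * of_real t) * exp (- \<gamma> * of_real t) * c - exp ((\<mu> - \<gamma>) * of_real t) * c"
      by (simp add: right_diff_distrib mult_ac)
    also have "\<dots> = 0" by (simp add: algebra_simps flip: exp_add)
    finally show ?thesis by (simp add: v_def[abs_def])
  qed
  then have "v T = v 0"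
    using has_vector_derivative_zero_constant[of "{0..T}" v] T by (metis atLeastAtMost_iff convex_real_interval(5) order_refl less_imp_le)
  then have "exp (\<mu> * of_real T) * u T = (exp ((\<mu> - \<gamma>) * of_real T) - 1) / (\<mu> - \<gamma>) * c"
    using u0 by (simp add: v_def field_simps diff_divide_distrib)
  then have *: "exp (- \<mu> * of_real T) * (exp (\<mu> * of_real T) * u T) * (\<mu> - \<gamma>)
      = exp (- \<mu> * of_real T) * (exp ((\<mu> - \<gamma>) * of_real T) - 1) * c"
    using ne by simp
  have "exp (- \<mu> * of_real T) * (exp (\<mu> * of_real T) * u T) = u T"
    by (simp flip: exp_add mult.assoc)
  moreover have "exp (- \<mu> * of_real T) * (exp ((\<mu> - \<gamma>) * of_real T) - 1) = exp (- \<gamma> * of_real T) - exp (- \<mu> * of_real T)"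
    by (simp add: algebra_simps flip: exp_add)
  ultimately show ?thesis using * by (simp only: mult.commute)
qed

subsection \<open>Stability\<close>

text \<open>Lebesgue measure is complete, so f inherits measurability from g. This serves the
  coefficient of the weak time derivative, which is known only through its continuous
  almost-everywhere version.\<close>

lemma lebesgue_on_integral_cong_AE:
  fixes f g :: "'a::euclidean_space \<Rightarrow> complex"
  assumes S: "S \<in> sets lebesgue" and g: "g \<in> borel_measurable (lebesgue_on S)"
    and ae: "AE x in lebesgue_on S. f x = g x"
  shows "(LINT x|lebesgue_on S. f x) = (LINT x|lebesgue_on S. g x)"
proof -
  have gm: "(\<lambda>x. indicator S x *\<^sub>R g x) \<in> borel_measurable lebesgue"
    using g S by (subst (asm) borel_measurable_restrict_space_iff) auto
  have ae': "AE x in lebesgue. indicator S x *\<^sub>R g x = indicator S x *\<^sub>R f x"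
    using ae S by (subst (asm) AE_restrict_space_iff) (auto simp: indicator_def elim: eventually_mono)
  have "(\<lambda>x. indicator S x *\<^sub>R f x) \<in> borel_measurable lebesgue"
    by (rule borel_measurable_AE[OF gm ae'])
  then have "(LINT x|lebesgue. indicator S x *\<^sub>R g x) = (LINT x|lebesgue. indicator S x *\<^sub>R f x)"
    by (intro integral_cong_AE gm ae')
  then show ?thesis using S by (simp add: integral_restrict_space)
qed

lemma continuous_on_L2_inner:
  assumes "L2_continuous T \<Omega> u" "h \<in> L2 \<Omega>"
  shows "continuous_on {0..T} (\<lambda>t. L2_inner \<Omega> (u t) h)"
  unfolding continuous_on_def
proof
  fix t assume t: "t \<in> {0..T}"
  have lim: "((\<lambda>s. L2_norm \<Omega> (\<lambda>x. u s x - u t x) * L2_norm \<Omega> h) \<longlongrightarrow> 0) (at t within {0..T})"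
    using assms(1) t by (intro tendsto_mult_left_zero) (simp add: L2_continuous_def)
  have "((\<lambda>s. L2_inner \<Omega> (u s) h - L2_inner \<Omega> (u t) h) \<longlongrightarrow> 0) (at t within {0..T})"
  proof (rule Lim_null_comparison[OF _ lim])
    show "\<forall>\<^sub>F s in at t within {0..T}. norm (L2_inner \<Omega> (u s) h - L2_inner \<Omega> (u t) h)
        \<le> L2_norm \<Omega> (\<lambda>x. u s x - u t x) * L2_norm \<Omega> h"
      unfolding eventually_at_filter
      using assms t by (intro always_eventually allI impI L2_inner_diff_bound) (auto simp: L2_continuous_def)
  qed
  then show "((\<lambda>s. L2_inner \<Omega> (u s) h) \<longlongrightarrow> L2_inner \<Omega> (u t) h) (at t within {0..T})"
    by (rule LIM_zero_cancel)
qed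

lemma weak_time_deriv_spec:
  assumes "u \<in> H1_time_L2 T \<Omega>"
  shows "weak_time_deriv T \<Omega> u \<in> L2_time_L2 T \<Omega>" "has_weak_time_deriv T \<Omega> u (weak_time_deriv T \<Omega> u)"
proof -
  obtain v where "v \<in> L2_time_L2 T \<Omega> \<and> has_weak_time_deriv T \<Omega> u v"
    using assms by (auto simp: H1_time_L2_def)
  then have "weak_time_deriv T \<Omega> u \<in> L2_time_L2 T \<Omega> \<and> has_weak_time_deriv T \<Omega> u (weak_time_deriv T \<Omega> u)"
    unfolding weak_time_deriv_def by (rule someI[where P="\<lambda>v. v \<in> L2_time_L2 T \<Omega> \<and> has_weak_time_deriv T \<Omega> u v"])
  then show "weak_time_deriv T \<Omega> u \<in> L2_time_L2 T \<Omega>" "has_weak_time_deriv T \<Omega> u (weak_time_deriv T \<Omega> u)"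
    by auto
qed

lemma bochner_L2_AE_in: "u \<in> bochner_L2 T X N \<Longrightarrow> AE t in lebesgue_on {0<..<T}. u t \<in> X"
  by (simp add: bochner_L2_def)

text \<open>Equal exponentials have exponents differing by an integer multiple of 2 pi i; dividing
  by T turns this into membership in the excluded set.\<close>

lemma nonresonant:
  fixes \<gamma> :: complex
  assumes "T > 0" and "\<gamma> \<notin> (\<Union>k::int. \<Union>n\<in>UNIV - {0}.
                {of_real (a * ev n) + \<i> * of_real (b * ev n - 2 * of_int k * pi / T)})" and n: "n \<ge> (1::nat)"
  shows "exp (- \<gamma> * of_real T) \<noteq> exp (- (Complex a b * of_real (ev n)) * of_real T)"
proof
  assume "exp (- \<gamma> * of_real T) = exp (- (Complex a b * of_real (ev n)) * of_real T)"
  then obtain k :: int where "- \<gamma> * of_real T = - (Complex a b * of_real (ev n)) * of_real T + of_int (2 * k) * pi * \<i>"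
    unfolding exp_eq by blast
  then have "\<gamma> * of_real T = (of_real (a * ev n) + \<i> * of_real (b * ev n - 2 * of_int k * pi / T)) * of_real T"
    using \<open>T > 0\<close> by (simp add: complex_eq_iff field_simps)
  then have "\<gamma> = of_real (a * ev n) + \<i> * of_real (b * ev n - 2 * of_int k * pi / T)"
    using \<open>T > 0\<close> by simp
  moreover have "n \<in> UNIV - {0}" using n by simp
  ultimately show False using assms(2) by blast
qed

section \<open>Coefficients of the source and of the final state\<close>

context bounded_domain_eigensystem
begin

text \<open>Pairing the equation with an eigenfunction replaces the Laplacian by a scalar. The
  resulting right side \<open>h\<close> involves t only through an exponential and the continuous
  coefficient \<open>y\<close>, so the weak equation becomes a classical one on the closed
  interval.\<close>

lemma coefficient_final_value:
  assumes T: "T > 0" and n: "n \<ge> 1" and u1: "u \<in> H1_time_L2 T \<Omega>" and u2: "u \<in> L2_time_H2 T \<Omega>"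
    and f: "f \<in> L2 \<Omega>"
    and sol: "solves_ibvp a b T \<Omega> (\<lambda>t. exp (- \<gamma> * of_real t)) f (\<lambda>_. 0) u"
    and ne: "Complex a b * of_real (ev n) \<noteq> \<gamma>"
  shows "(Complex a b * of_real (ev n) - \<gamma>) * L2_inner \<Omega> (u T) (\<phi> n) =
    (exp (- \<gamma> * of_real T) - exp (- (Complex a b * of_real (ev n)) * of_real T)) * L2_inner \<Omega> f (\<phi> n)"
proof -
  let ?v = "weak_time_deriv T \<Omega> u" and ?c = "Complex a b" and ?\<mu> = "Complex a b * of_real (ev n)"
  define y where "y t = L2_inner \<Omega> (u t) (\<phi> n)" for t
  define h where "h t = exp (- \<gamma> * of_real t) * L2_inner \<Omega> f (\<phi> n) - ?\<mu> * y t" for t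
  note \<phi>n = \<phi>_L2[OF n]
  have cont: "L2_continuous T \<Omega> u" using sol by (simp add: solves_ibvp_def)
  have yc: "continuous_on {0..T} y" unfolding y_def by (rule continuous_on_L2_inner[OF cont \<phi>n])
  have hc: "continuous_on {0..T} h" unfolding h_def by (intro continuous_intros yc)
  have ae: "AE t in lebesgue_on {0<..<T}. L2_inner \<Omega> (?v t) (\<phi> n) = h t"
  proof -
    have "AE t in lebesgue_on {0<..<T}. ?v t \<in> L2 \<Omega>" "AE t in lebesgue_on {0<..<T}. u t \<in> sobolev 2 \<Omega>"
      using bochner_L2_AE_in weak_time_deriv_spec(1)[OF u1] u2 by blast+
    moreover have "AE t in lebesgue_on {0<..<T}. u t \<in> H10 \<Omega>"
      "AE t in lebesgue_on {0<..<T}. AE x in lebesgue_on \<Omega>. ?v t x - ?c * laplacian \<Omega> (u t) x = exp (- \<gamma> * of_real t) * f x"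
      using sol by (auto simp: solves_ibvp_def)
    ultimately show ?thesis
    proof eventually_elim
      case (elim t)
      note L = laplacian_L2[OF elim(2)]
      have "AE x in lebesgue_on \<Omega>. ?v t x = exp (- \<gamma> * of_real t) * f x + ?c * laplacian \<Omega> (u t) x"
        using elim(4) by eventually_elim (simp add: algebra_simps)
      then have "L2_inner \<Omega> (?v t) (\<phi> n)
          = L2_inner \<Omega> (\<lambda>x. exp (- \<gamma> * of_real t) * f x + ?c * laplacian \<Omega> (u t) x) (\<phi> n)"
        by (intro L2_inner_cong_AE elim(1) L2_add L2_cmult f L \<phi>n)
      also have "\<dots> = exp (- \<gamma> * of_real t) * L2_inner \<Omega> f (\<phi> n) + ?c * L2_inner \<Omega> (laplacian \<Omega> (u t)) (\<phi> n)"
        by (simp only: L2_inner_add_left[OF L2_cmult[OF f] L2_cmult[OF L] \<phi>n] L2_inner_cmult_left)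
      also have "\<dots> = h t"
        unfolding laplacian_coefficient[OF elim(2,3) n] by (simp add: h_def y_def)
      finally show ?case .
    qed
  qed
  have weak: "(LINT t|lebesgue_on {0<..<T}. of_real (deriv \<eta> t) * y t) = - (LINT t|lebesgue_on {0<..<T}. of_real (\<eta> t) * h t)"
    if \<eta>: "test_function {0<..<T} \<eta>" for \<eta>
  proof -
    have "continuous_on {0..T} \<eta>"
      using Ck_imp_continuous[OF test_function_Ck[OF \<eta>, of 0]] by (auto intro: continuous_on_subset)
    then have "integrable (lebesgue_on {0<..<T}) (\<lambda>t. of_real (\<eta> t) * h t)"
      by (intro lebesgue_on_open_interval_eq_integral(1) continuous_intros hc)
    then have "(LINT t|lebesgue_on {0<..<T}. of_real (\<eta> t) * L2_inner \<Omega> (?v t) (\<phi> n))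
        = (LINT t|lebesgue_on {0<..<T}. of_real (\<eta> t) * h t)"
      using ae by (intro lebesgue_on_integral_cong_AE) (auto elim: eventually_mono)
    then show ?thesis
      using weak_time_deriv_spec(2)[OF u1] \<eta> \<phi>n by (simp add: has_weak_time_deriv_def y_def)
  qed
  have D: "(y has_vector_derivative h t) (at t within {0..T})" if "t \<in> {0..T}" for t
    by (rule weak_derivative_imp_has_vector_derivative[OF T yc hc weak that])
  have "L2_inner \<Omega> (u 0) (\<phi> n) = L2_inner \<Omega> (\<lambda>x. 0) (\<phi> n)"
    using sol cont T by (intro L2_inner_cong_AE L2_zero \<phi>n) (auto simp: solves_ibvp_def L2_continuous_def)
  then have "y 0 = 0" by (simp add: y_def L2_inner_zero_left)
  from linear_ode_final_value[OF T this ne D[unfolded h_def]]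
  show ?thesis by (simp add: y_def)
qed

text \<open>Divided by the eigenvalue, the left side tends to the modulus of a + ib, while the
  exponential difference tends to exp(-\<gamma> T), which is nonzero; here a > 0 makes the second
  exponential decay. A convergent sequence of quotients is bounded, its initial terms
  included.\<close>

lemma coefficient_ratio_bounded:
  assumes a: "a > 0" and T: "T > 0"
    and nr: "\<And>n. n \<ge> 1 \<Longrightarrow> exp (- \<gamma> * of_real T) \<noteq> exp (- (Complex a b * of_real (ev n)) * of_real T)"
  shows "\<exists>K>0. \<forall>n\<ge>1. cmod (Complex a b * of_real (ev n) - \<gamma>)
    \<le> K * ev n * cmod (exp (- \<gamma> * of_real T) - exp (- (Complex a b * of_real (ev n)) * of_real T))"
proof -
  let ?e = "\<lambda>n. ev (Suc n)"
  let ?E = "\<lambda>n. exp (- \<gamma> * of_real T) - exp (- (Complex a b * of_real (?e n)) * of_real T)"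
  have epos: "?e n > 0" for n by (rule ev_pos) simp
  have "(\<lambda>n. inverse (?e n)) \<longlonglongrightarrow> 0"
    by (rule tendsto_inverse_0_at_top[OF ev_at_top])
  then have lim: "(\<lambda>n. Complex a b - \<gamma> * of_real (inverse (?e n))) \<longlonglongrightarrow> Complex a b - \<gamma> * of_real 0"
    by (intro tendsto_intros)
  have "(\<lambda>n. exp (- (Complex a b * of_real (?e n)) * of_real T)) \<longlonglongrightarrow> 0"
  proof (rule tendsto_norm_zero_cancel)
    have "filterlim (\<lambda>n. a * T * ?e n) at_top sequentially"
      using a T by (intro filterlim_tendsto_pos_mult_at_top[OF tendsto_const _ ev_at_top]) simp
    then have "(\<lambda>n. exp (- (a * T * ?e n))) \<longlonglongrightarrow> 0"
      by (intro filterlim_compose[OF exp_at_bot] filterlim_compose[OF filterlim_uminus_at_bot_at_top])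
    then show "(\<lambda>n. cmod (exp (- (Complex a b * of_real (?e n)) * of_real T))) \<longlonglongrightarrow> 0"
      by (simp add: norm_exp_eq_Re mult_ac)
  qed
  then have "(\<lambda>n. (Complex a b - \<gamma> * of_real (inverse (?e n))) / ?E n)
      \<longlonglongrightarrow> (Complex a b - \<gamma> * of_real 0) / (exp (- \<gamma> * of_real T) - 0)"
    by (intro tendsto_divide[OF lim tendsto_diff[OF tendsto_const]]) simp_all
  then have "Bseq (\<lambda>n. (Complex a b - \<gamma> * of_real (inverse (?e n))) / ?E n)"
    by (intro convergent_imp_Bseq convergentI)
  then obtain K where K: "K > 0" "\<And>n. cmod ((Complex a b - \<gamma> * of_real (inverse (?e n))) / ?E n) \<le> K"
    by (auto simp: Bseq_def)
  have "cmod (Complex a b * of_real (?e n) - \<gamma>) \<le> K * ?e n * cmod (?E n)" for n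
  proof -
    \<comment> \<open>A quotient with zero denominator counts as 0, so the bound on the quotients
      yields one on the numerators only through nonresonance.\<close>
    have ne: "?E n \<noteq> 0" using nr[of "Suc n"] by simp
    have "Complex a b * of_real (?e n) - \<gamma> = of_real (?e n) * (Complex a b - \<gamma> * of_real (inverse (?e n)))"
      using epos[of n] by (simp add: field_simps)
    then have "cmod (Complex a b * of_real (?e n) - \<gamma>) = ?e n * cmod (Complex a b - \<gamma> * of_real (inverse (?e n)))"
      using epos[of n] by (simp only: norm_mult norm_of_real)
    also have "cmod (Complex a b - \<gamma> * of_real (inverse (?e n))) \<le> K * cmod (?E n)"
      using K(2)[of n] ne unfolding norm_divide by (simp add: field_simps)
    finally show ?thesis using epos[of n] by (simp add: mult_ac)
  qed
  then have "\<forall>n\<ge>1. cmod (Complex a b * of_real (ev n) - \<gamma>)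
      \<le> K * ev n * cmod (exp (- \<gamma> * of_real T) - exp (- (Complex a b * of_real (ev n)) * of_real T))"
    by (metis Suc_le_D One_nat_def)
  then show ?thesis using K(1) by blast
qed

text \<open>The factor \<open>ev n\<close> is absorbed by one of the two copies of the coefficient
  of f, turning it into a coefficient of the Laplacian; Bessel's inequality then bounds the finite
  sums uniformly.\<close>

lemma L2_norm_square_le_if_coefficients_le:
  assumes f: "f \<in> sobolev 2 \<Omega>" "f \<in> H10 \<Omega>" and w: "w \<in> L2 \<Omega>" and K: "K \<ge> 0"
    and le: "\<And>n. n \<ge> 1 \<Longrightarrow> cmod (L2_inner \<Omega> f (\<phi> n)) \<le> K * ev n * cmod (L2_inner \<Omega> w (\<phi> n))"
  shows "(L2_norm \<Omega> f)\<^sup>2 \<le> K * (L2_norm \<Omega> (laplacian \<Omega> f) * L2_norm \<Omega> w)"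
proof (rule LIMSEQ_le_const2[OF parseval[OF eigensystem sobolev_imp_L2[OF f(1)]]], intro exI[of _ 0] allI impI)
  fix N
  let ?l = "\<lambda>n. cmod (L2_inner \<Omega> (laplacian \<Omega> f) (\<phi> n))" and ?w = "\<lambda>n. cmod (L2_inner \<Omega> w (\<phi> n))"
  have "(\<Sum>n=1..N. (cmod (L2_inner \<Omega> f (\<phi> n)))\<^sup>2) \<le> (\<Sum>n=1..N. K * (\<bar>?l n\<bar> * \<bar>?w n\<bar>))"
  proof (rule sum_mono)
    fix n assume "n \<in> {1..N}"
    then have n: "n \<ge> 1" by simp
    have "(cmod (L2_inner \<Omega> f (\<phi> n)))\<^sup>2 \<le> cmod (L2_inner \<Omega> f (\<phi> n)) * (K * ev n * ?w n)"
      unfolding power2_eq_square by (intro mult_left_mono le n) simp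
    then show "(cmod (L2_inner \<Omega> f (\<phi> n)))\<^sup>2 \<le> K * (\<bar>?l n\<bar> * \<bar>?w n\<bar>)"
      unfolding laplacian_coefficient[OF f n] using ev_pos[OF n] by (simp add: norm_mult mult_ac)
  qed
  also have "\<dots> \<le> K * (L2_set ?l {1..N} * L2_set ?w {1..N})"
    unfolding sum_distrib_left[symmetric] by (intro mult_left_mono L2_set_mult_ineq K)
  also have "\<dots> \<le> K * (L2_norm \<Omega> (laplacian \<Omega> f) * L2_norm \<Omega> w)"
    unfolding L2_set_def
    by (intro mult_left_mono mult_mono K real_le_lsqrt bessel[OF eigensystem] laplacian_L2 f w)
      (auto intro: sum_nonneg)
  finally show "(\<Sum>n=1..N. (cmod (L2_inner \<Omega> f (\<phi> n)))\<^sup>2) \<le> K * (L2_norm \<Omega> (laplacian \<Omega> f) * L2_norm \<Omega> w)" .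
qed

end

theorem theorem1:
  fixes a b T M :: real and \<gamma> :: complex
    and \<Omega> :: "(real^'d) set"
    and ev :: "nat \<Rightarrow> real" and \<phi> :: "nat \<Rightarrow> real^'d \<Rightarrow> complex"
  assumes "a > 0" and "b \<noteq> 0" and "T > 0"
    and "open \<Omega>" and "connected \<Omega>" and "\<Omega> \<noteq> {}" and "bounded \<Omega>"
    and "analytic_hypersurface (frontier \<Omega>)"
    and "dirichlet_eigensystem \<Omega> ev \<phi>"
    and "\<gamma> \<notin> (\<Union>k::int. \<Union>n\<in>UNIV - {0}.
                {of_real (a * ev n) + \<i> * of_real (b * ev n - 2 * of_int k * pi / T)})"
    and "M > 0"
  shows "\<exists>C>0. \<forall>u f.
           u \<in> H1_time_L2 T \<Omega> \<inter> L2_time_H2 T \<Omega> \<and>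
           f \<in> sobolev 2 \<Omega> \<inter> H10 \<Omega> \<and>
           solves_ibvp a b T \<Omega> (\<lambda>t. exp (- \<gamma> * of_real t)) f (\<lambda>_. 0) u \<and>
           sobolev_norm 2 \<Omega> f \<le> M
           \<longrightarrow> L2_norm \<Omega> f \<le> C * sqrt M * sqrt (L2_norm \<Omega> (u T))"
proof -
  interpret bounded_domain_eigensystem \<Omega> ev \<phi>
    by unfold_locales fact+
  let ?\<mu> = "\<lambda>n. Complex a b * of_real (ev n)"
  let ?E = "\<lambda>n. exp (- \<gamma> * of_real T) - exp (- ?\<mu> n * of_real T)"
  note nr = nonresonant[OF \<open>T > 0\<close> assms(10)]
  obtain K where K: "K > 0" "\<And>n. n \<ge> 1 \<Longrightarrow> cmod (?\<mu> n - \<gamma>) \<le> K * ev n * cmod (?E n)"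
    using coefficient_ratio_bounded[OF \<open>a > 0\<close> \<open>T > 0\<close> nr] by blast
  let ?d = "real DIM(real^'d)"
  show ?thesis
  \<comment> \<open>\<open>K\<close> is the uniform bound on the coefficient ratios,
    \<open>?d\<close> the factor comparing the Laplacian with the Sobolev norm; the root comes from
    the estimate of the squared norm of f.\<close>
  proof (intro exI[of _ "sqrt (K * ?d)"] conjI allI impI)
    show "sqrt (K * ?d) > 0" using K(1) by simp
    fix u f
    assume "u \<in> H1_time_L2 T \<Omega> \<inter> L2_time_H2 T \<Omega> \<and> f \<in> sobolev 2 \<Omega> \<inter> H10 \<Omega> \<and>
           solves_ibvp a b T \<Omega> (\<lambda>t. exp (- \<gamma> * of_real t)) f (\<lambda>_. 0) u \<and> sobolev_norm 2 \<Omega> f \<le> M"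
    then have u: "u \<in> H1_time_L2 T \<Omega>" "u \<in> L2_time_H2 T \<Omega>" and f: "f \<in> sobolev 2 \<Omega>" "f \<in> H10 \<Omega>"
      and sol: "solves_ibvp a b T \<Omega> (\<lambda>t. exp (- \<gamma> * of_real t)) f (\<lambda>_. 0) u" and M: "sobolev_norm 2 \<Omega> f \<le> M"
      by auto
    have uT: "u T \<in> L2 \<Omega>" using sol \<open>T > 0\<close> by (simp add: solves_ibvp_def L2_continuous_def)
    have "cmod (L2_inner \<Omega> f (\<phi> n)) \<le> K * ev n * cmod (L2_inner \<Omega> (u T) (\<phi> n))" if n: "n \<ge> 1" for n
    proof -
      have E: "?E n \<noteq> 0" using nr[OF n] by simp
      \<comment> \<open>The case k = 0 of nonresonance: equal exponents would make
        \<open>?E n\<close> vanish.\<close>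
      then have "?\<mu> n \<noteq> \<gamma>" by auto
      from coefficient_final_value[OF \<open>T > 0\<close> n u sobolev_imp_L2[OF f(1)] sol this]
      have "cmod (?E n) * cmod (L2_inner \<Omega> f (\<phi> n)) = cmod (?\<mu> n - \<gamma>) * cmod (L2_inner \<Omega> (u T) (\<phi> n))"
        by (simp only: norm_mult[symmetric])
      also have "\<dots> \<le> K * ev n * cmod (?E n) * cmod (L2_inner \<Omega> (u T) (\<phi> n))"
        by (intro mult_right_mono K n) simp
      also have "\<dots> = cmod (?E n) * (K * ev n * cmod (L2_inner \<Omega> (u T) (\<phi> n)))"
        by (simp only: mult_ac)
      finally show ?thesis using E by (simp only: mult_le_cancel_left_pos zero_less_norm_iff not_False_eq_True)
    qed
    then have "(L2_norm \<Omega> f)\<^sup>2 \<le> K * (L2_norm \<Omega> (laplacian \<Omega> f) * L2_norm \<Omega> (u T))"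
      using K(1) by (intro L2_norm_square_le_if_coefficients_le f uT) auto
    also have "\<dots> \<le> K * (?d * M * L2_norm \<Omega> (u T))"
      using K(1) order_trans[OF laplacian_norm_le[OF f(1)] mult_left_mono[OF M of_nat_0_le_iff]]
      by (intro mult_left_mono mult_right_mono) simp_all
    finally have "L2_norm \<Omega> f \<le> sqrt (K * (?d * M * L2_norm \<Omega> (u T)))"
      by (rule real_le_rsqrt)
    then show "L2_norm \<Omega> f \<le> sqrt (K * ?d) * sqrt M * sqrt (L2_norm \<Omega> (u T))"
      by (simp add: real_sqrt_mult mult.assoc)
  qed
qed

end
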